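(* Suppose that Assumptions (I) and (II) listed in the context hold, and let $\alpha>0$. Define $u_0:=0$ and $u_{k+1}:=Tu_k$ for $k\ge 0$, where $T:B_W(\mathbb N_0\times\mathbb N_0)\to B_W(\mathbb N_0\times\mathbb N_0)$ is $$Tu(n,i):=\inf_{a\in[\gamma,R]}\left[\frac{r(n,i,a)}{R+\alpha+\lambda+\mu}+\frac{R+\lambda+\mu}{R+\alpha+\lambda+\mu}\sum_{(m,j)\in\mathbb N_0\times\mathbb N_0}p^{a}_{(n,i)(m,j)}u(m,j)\right],\qquad p^{a}_{(n,i)(m,j)}:=\frac{\pi^{a}_{(n,i)(m,j)}}{R+\lambda+\mu}+\delta_{(n,i)(m,j)} .$$ Then the following hold. (a) The sequence $\{u_k\}_{k\ge0}$ is monotone nondecreasing, and the (pointwise) limit $u^*:=\lim_{k\to\infty}u_k$ is in $B_W(\mathbb N_0\times\mathbb N_0)$. (b) $u^*=Tu^*$; equivalently, $u^*$ satisfies the discounted-cost optimality equation (DCOE) $$\alpha u^*(n,i)=\inf_{a\in[\gamma,R]}\Big\{r(n,i,a)+\sum_{(m,j)\in\mathbb N_0\times\mathbb N_0}\pi^{a}_{(n,i)(m,j)}u^*(m,j)\Big\}\qquad\text{for all }(n,i)\in\mathbb N_0\times\mathbb N_0 .$$ (c) There exist stationary policies $\beta_k\in\mathscr U_{SM}$ (for each $k\ge0$) and $\beta^*_\alpha\in\mathscr U_{SM}$ attaining the minimum in the equations $u_{k+1}=Tu_k$ and in the DCOE, respectively. Moreover $u^*=I^*_\alpha$, and the policy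 $\beta^*_\alpha$ is discounted-cost optimal. (d) Every limit point in $\mathscr U_{SM}$ of the sequence $\{\beta_k\}$ in (c) is a discounted-cost optimal stationary policy.
   Context: Notation: $\mathbb N_0=\{0,1,2,\dots\}$; $\delta_{(n,i)(m,j)}$ is the Kronecker delta on $\mathbb N_0\times\mathbb N_0$. Control model: $\lambda,\mu>0$ and $0<\gamma\le R<\infty$ are constants. The state space is $\mathbb N_0\times\mathbb N_0$ (state $(n,i)$: $n$ customers, $i$ items in inventory), the action space in every state is $[\gamma,R]$ (production rates). For $a\in[\gamma,R]$ the transition rates are: $\pi^{a}_{(n,i)(n,i+1)}=a$ for all $n,i\ge0$; $\pi^{a}_{(n,i)(n+1,i)}=\lambda$ for $n\ge0,i\ge1$; $\pi^{a}_{(n,i)(n-1,i-1)}=\mu$ for $n,i\ge1$; all other off-diagonal rates are $0$; and $\pi^{a}_{(n,i)(n,i)}=-\sum_{(m,j)\ne(n,i)}\pi^a_{(n,i)(m,j)}$. Put $\pi^*_{(n,i)}:=\sup_{a\in[\gamma,R]}\big(-\pi^{a}_{(n,i)(n,i)}\big)$. The cost rate is $r(n,i,a)=c_0\, i+c_1 n+a\,c_2\,\mathbf 1_{\{i>S\}}+c_3\,n\,\mathbf 1_{\{i=0\}}$ with constants $c_0,c_1,c_2,c_3\ge0$ and $S\in\mathbb N_0$. Policies: $\mathscr U_{SM}$ is the set of all functions $\beta:\mathbb N_0\times\mathbb N_0\to[\gamma,R]$ (deterministic stationary policies), with the product topology (pointwise convergence). For $\beta\in\mathscr U_{SM}$,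 write $\pi^\beta_{(n,i)(m,j)}=\pi^{\beta(n,i)}_{(n,i)(m,j)}$, let $Y(t)$ be the right-continuous Markov chain with these rates, and let $P^\beta_{(n,i)},E^\beta_{(n,i)}$ be the probability and expectation when $Y(0)=(n,i)$. Criterion: $I^\beta_\alpha(n,i)=E^\beta_{(n,i)}\int_0^\infty e^{-\alpha t}r(Y(t),\beta(Y(t-)))\,dt$ and $I^*_\alpha(n,i)=\inf_{\beta\in\mathscr U_{SM}}I^\beta_\alpha(n,i)$; $\beta^*$ is discounted-cost optimal if $I^{\beta^*}_\alpha(n,i)=I^*_\alpha(n,i)$ for all $(n,i)$. Weighted space: for $V\ge1$, $\|u\|_V=\sup_{(n,i)}|u(n,i)|/V(n,i)$ and $B_V(\mathbb N_0\times\mathbb N_0)=\{u:\mathbb N_0\times\mathbb N_0\to\mathbb R:\|u\|_V<\infty\}$. Assumption (I): there are a function $W\ge1$ on $\mathbb N_0\times\mathbb N_0$, nondecreasing along some fixed enumeration of $\mathbb N_0\times\mathbb N_0$, and constants $\bar c_1>0$, $\bar b_1\ge0$, $M>0$ such that for all $(n,i)$ and $a\in[\gamma,R]$: $\sum_{(m,j)}\pi^{a}_{(n,i)(m,j)}W(m,j)\le-\bar c_1W(n,i)+\bar b_1\delta_{(n,i)(0,0)}$ and $r(n,i,a)\le M\,W(n,i)$. Assumption (II): with $W$ as in (I), there are a nonnegative function $W'$ on $\mathbb N_0\times\mathbb N_0$ and constants $c'>0$, $b'\ge0$, $M'>0$ such that for all $(n,i)$ and $a\in[\gamma,R]$: $\pi^*_{(n,i)}W(n,i)\le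 M'W'(n,i)$ and $\sum_{(m,j)}\pi^{a}_{(n,i)(m,j)}W'(m,j)\le c'W'(n,i)+b'$. *)

theory Defs
  imports "HOL-Probability.Probability"
begin

text \<open>A state \<open>(n, i)\<close> consists of \<open>n\<close> customers and \<open>i\<close> items in inventory.\<close>

type_synonym state = "nat \<times> nat"
type_synonym policy = "state \<Rightarrow> real"

record inventory_model =
  arrival :: real                \<comment> \<open>\<open>\<lambda>\<close>\<close>
  service :: real                \<comment> \<open>\<open>\<mu>\<close>\<close>
  min_prod :: real               \<comment> \<open>\<open>\<gamma>\<close>\<close>
  max_prod :: real               \<comment> \<open>\<open>R\<close>\<close>
  cost_hold :: real              \<comment> \<open>\<open>c\<^sub>0\<close>\<close>
  cost_wait :: real              \<comment> \<open>\<open>c\<^sub>1\<close>\<close>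
  cost_prod :: real              \<comment> \<open>\<open>c\<^sub>2\<close>\<close>
  cost_short :: real             \<comment> \<open>\<open>c\<^sub>3\<close>\<close>
  threshold :: nat               \<comment> \<open>\<open>S\<close>\<close>

definition valid_model :: "inventory_model \<Rightarrow> bool" where
  "valid_model m \<longleftrightarrow>
     arrival m > 0 \<and> service m > 0 \<and> 0 < min_prod m \<and> min_prod m \<le> max_prod m \<and>
     cost_hold m \<ge> 0 \<and> cost_wait m \<ge> 0 \<and> cost_prod m \<ge> 0 \<and> cost_short m \<ge> 0"

definition actions :: "inventory_model \<Rightarrow> real set" where
  "actions m = {min_prod m..max_prod m}"

definition kdelta :: "state \<Rightarrow> state \<Rightarrow> real" where
  "kdelta x y = (if x = y then 1 else 0)"

fun jump_rate :: "inventory_model \<Rightarrow> real \<Rightarrow> state \<Rightarrow> state \<Rightarrow> real" where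
  "jump_rate m a (n, i) (n', i') =
     (if n' = n \<and> i' = Suc i then a
      else if 1 \<le> i \<and> n' = Suc n \<and> i' = i then arrival m
      else if 1 \<le> n \<and> 1 \<le> i \<and> n' = n - 1 \<and> i' = i - 1 then service m
      else 0)"

text \<open>All sums over the state space below have finitely many nonzero terms.\<close>

definition rate :: "inventory_model \<Rightarrow> real \<Rightarrow> state \<Rightarrow> state \<Rightarrow> real" where
  "rate m a x y =
     (if x = y then - (\<Sum>\<^sub>\<infinity>z\<in>UNIV - {x}. jump_rate m a x z) else jump_rate m a x y)"

definition max_exit_rate :: "inventory_model \<Rightarrow> state \<Rightarrow> real" where
  "max_exit_rate m x = (SUP a\<in>actions m. - rate m a x x)"

fun cost :: "inventory_model \<Rightarrow> state \<Rightarrow> real \<Rightarrow> real" where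
  "cost m (n, i) a =
     cost_hold m * real i + cost_wait m * real n
     + a * cost_prod m * of_bool (i > threshold m)
     + cost_short m * real n * of_bool (i = 0)"

definition policies :: "inventory_model \<Rightarrow> policy set" where
  "policies m = {\<beta>. \<forall>x. \<beta> x \<in> actions m}"

definition transition_function :: "(real \<Rightarrow> state \<Rightarrow> state \<Rightarrow> real) \<Rightarrow> bool" where
  "transition_function p \<longleftrightarrow>
     (\<forall>x y. p 0 x y = kdelta x y) \<and>
     (\<forall>t\<ge>0. \<forall>x. (\<forall>y. 0 \<le> p t x y) \<and> (p t x has_sum 1) UNIV) \<and>
     (\<forall>s\<ge>0. \<forall>t\<ge>0. \<forall>x y. ((\<lambda>z. p s x z * p t z y) has_sum p (s + t) x y) UNIV)"

text \<open>
  Under \<open>P\<close>, the process \<open>(Y t)\<close>, \<open>t \<ge> 0\<close>, is a right-continuous time-homogeneous Markov chain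
  with rates \<open>q\<close> and initial state \<open>x\<close>: its transition function has right derivative \<open>q\<close> at time \<open>0\<close>
  and determines its finite-dimensional distributions. Values of \<open>Y\<close> at negative times are irrelevant.
\<close>

definition markov_chain ::
  "(state \<Rightarrow> state \<Rightarrow> real) \<Rightarrow> state \<Rightarrow> 'w measure \<Rightarrow> (real \<Rightarrow> 'w \<Rightarrow> state) \<Rightarrow> bool" where
  "markov_chain q x P Y \<longleftrightarrow>
     prob_space P \<and>
     (\<forall>t\<ge>0. Y t \<in> measurable P (count_space UNIV)) \<and>
     (\<forall>\<omega>\<in>space P. \<forall>t\<ge>0. ((\<lambda>s. Y s \<omega>) \<longlongrightarrow> Y t \<omega>) (at_right t)) \<and>
     (\<exists>p. transition_function p \<and>
          (\<forall>y z. ((\<lambda>t. p t y z) has_real_derivative q y z) (at 0 within {0..})) \<and>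
          (\<forall>k (t :: nat \<Rightarrow> real) y.
             t 0 = 0 \<and> (\<forall>l<k. t l \<le> t (Suc l)) \<longrightarrow>
             measure P {\<omega> \<in> space P. \<forall>l\<le>k. Y (t l) \<omega> = y l} =
               kdelta x (y 0) * (\<Prod>l<k. p (t (Suc l) - t l) (y l) (y (Suc l)))))"

text \<open>
  \<open>P \<beta> x\<close> and \<open>Y \<beta> x\<close> are the probability measure and the process governed by the policy \<open>\<beta>\<close>
  started in \<open>x\<close>. Each pair may have its own sample space; a common canonical path space is the
  special case in which \<open>Y \<beta> x\<close> depends on neither \<open>\<beta>\<close> nor \<open>x\<close>.
\<close>

definition controlled_chains ::
  "inventory_model \<Rightarrow> (policy \<Rightarrow> state \<Rightarrow> 'w measure) \<Rightarrow>
   (policy \<Rightarrow> state \<Rightarrow> real \<Rightarrow> 'w \<Rightarrow> state) \<Rightarrow> bool" where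
  "controlled_chains m P Y \<longleftrightarrow>
     (\<forall>\<beta>\<in>policies m. \<forall>x. markov_chain (\<lambda>y. rate m (\<beta> y) y) x (P \<beta> x) (Y \<beta> x))"

text \<open>
  The cost is nonnegative, so the criterion is a Lebesgue integral with values in \<open>[0, \<infinity>]\<close>.
  \<open>Lim (at_left t)\<close> gives \<open>Y(t-)\<close>; a right-continuous path in a discrete space has only countably
  many discontinuities, so the times without a left limit (and \<open>t = 0\<close>) do not matter.
\<close>

definition discounted_cost ::
  "inventory_model \<Rightarrow> real \<Rightarrow> (policy \<Rightarrow> state \<Rightarrow> 'w measure) \<Rightarrow>
   (policy \<Rightarrow> state \<Rightarrow> real \<Rightarrow> 'w \<Rightarrow> state) \<Rightarrow> policy \<Rightarrow> state \<Rightarrow> ennreal" where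
  "discounted_cost m \<alpha> P Y \<beta> x =
     (\<integral>\<^sup>+ \<omega>. (\<integral>\<^sup>+ t \<in> {0..}.
        ennreal (exp (- \<alpha> * t) *
          cost m (Y \<beta> x t \<omega>) (\<beta> (Lim (at_left t) (\<lambda>s. Y \<beta> x s \<omega>)))) \<partial>lborel) \<partial>P \<beta> x)"

definition optimal_cost ::
  "inventory_model \<Rightarrow> real \<Rightarrow> (policy \<Rightarrow> state \<Rightarrow> 'w measure) \<Rightarrow>
   (policy \<Rightarrow> state \<Rightarrow> real \<Rightarrow> 'w \<Rightarrow> state) \<Rightarrow> state \<Rightarrow> ennreal" where
  "optimal_cost m \<alpha> P Y x = (INF \<beta>\<in>policies m. discounted_cost m \<alpha> P Y \<beta> x)"

definition discount_optimal ::
  "inventory_model \<Rightarrow> real \<Rightarrow> (policy \<Rightarrow> state \<Rightarrow> 'w measure) \<Rightarrow>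
   (policy \<Rightarrow> state \<Rightarrow> real \<Rightarrow> 'w \<Rightarrow> state) \<Rightarrow> policy \<Rightarrow> bool" where
  "discount_optimal m \<alpha> P Y \<beta> \<longleftrightarrow>
     \<beta> \<in> policies m \<and> (\<forall>x. discounted_cost m \<alpha> P Y \<beta> x = optimal_cost m \<alpha> P Y x)"

definition weighted_norm :: "(state \<Rightarrow> real) \<Rightarrow> (state \<Rightarrow> real) \<Rightarrow> ereal" where
  "weighted_norm V u = (SUP x. ereal (\<bar>u x\<bar> / V x))"

definition weighted_space :: "(state \<Rightarrow> real) \<Rightarrow> (state \<Rightarrow> real) set" where
  "weighted_space V = {u. weighted_norm V u < \<infinity>}"

definition assumption_I :: "inventory_model \<Rightarrow> (state \<Rightarrow> real) \<Rightarrow> bool" where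
  "assumption_I m W \<longleftrightarrow>
     (\<forall>x. 1 \<le> W x) \<and>
     (\<exists>e :: nat \<Rightarrow> state. bij e \<and> mono (\<lambda>k. W (e k))) \<and>
     (\<exists>c b M. c > 0 \<and> b \<ge> 0 \<and> M > 0 \<and>
        (\<forall>x. \<forall>a\<in>actions m.
           (\<Sum>\<^sub>\<infinity>y. rate m a x y * W y) \<le> - c * W x + b * kdelta x (0, 0) \<and>
           cost m x a \<le> M * W x))"

definition assumption_II :: "inventory_model \<Rightarrow> (state \<Rightarrow> real) \<Rightarrow> bool" where
  "assumption_II m W \<longleftrightarrow>
     (\<exists>W' c b M. (\<forall>x. 0 \<le> W' x) \<and> c > 0 \<and> b \<ge> 0 \<and> M > 0 \<and>
        (\<forall>x. \<forall>a\<in>actions m.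
           max_exit_rate m x * W x \<le> M * W' x \<and>
           (\<Sum>\<^sub>\<infinity>y. rate m a x y * W' y) \<le> c * W' x + b))"

definition total_rate :: "inventory_model \<Rightarrow> real" where
  "total_rate m = max_prod m + arrival m + service m"

definition unif_prob :: "inventory_model \<Rightarrow> real \<Rightarrow> state \<Rightarrow> state \<Rightarrow> real" where
  "unif_prob m a x y = rate m a x y / total_rate m + kdelta x y"

definition T_action ::
  "inventory_model \<Rightarrow> real \<Rightarrow> (state \<Rightarrow> real) \<Rightarrow> state \<Rightarrow> real \<Rightarrow> real" where
  "T_action m \<alpha> u x a =
     cost m x a / (total_rate m + \<alpha>)
     + total_rate m / (total_rate m + \<alpha>) * (\<Sum>\<^sub>\<infinity>y. unif_prob m a x y * u y)"

definition T_op :: "inventory_model \<Rightarrow> real \<Rightarrow> (state \<Rightarrow> real) \<Rightarrow> state \<Rightarrow> real" where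
  "T_op m \<alpha> u x = (INF a\<in>actions m. T_action m \<alpha> u x a)"

definition value_iter :: "inventory_model \<Rightarrow> real \<Rightarrow> nat \<Rightarrow> state \<Rightarrow> real" where
  "value_iter m \<alpha> k = (T_op m \<alpha> ^^ k) (\<lambda>_. 0)"

definition DCOE_action :: "inventory_model \<Rightarrow> (state \<Rightarrow> real) \<Rightarrow> state \<Rightarrow> real \<Rightarrow> real" where
  "DCOE_action m u x a = cost m x a + (\<Sum>\<^sub>\<infinity>y. rate m a x y * u y)"

definition DCOE :: "inventory_model \<Rightarrow> real \<Rightarrow> (state \<Rightarrow> real) \<Rightarrow> bool" where
  "DCOE m \<alpha> u \<longleftrightarrow> (\<forall>x. \<alpha> * u x = (INF a\<in>actions m. DCOE_action m u x a))"

definition iteration_selectors :: "inventory_model \<Rightarrow> real \<Rightarrow> (nat \<Rightarrow> policy) \<Rightarrow> bool" where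
  "iteration_selectors m \<alpha> \<beta>s \<longleftrightarrow>
     (\<forall>k. \<beta>s k \<in> policies m \<and>
        (\<forall>x. is_arg_min (T_action m \<alpha> (value_iter m \<alpha> k) x) (\<lambda>a. a \<in> actions m) (\<beta>s k x) \<and>
             value_iter m \<alpha> (Suc k) x = T_action m \<alpha> (value_iter m \<alpha> k) x (\<beta>s k x)))"

definition DCOE_selector :: "inventory_model \<Rightarrow> real \<Rightarrow> (state \<Rightarrow> real) \<Rightarrow> policy \<Rightarrow> bool" where
  "DCOE_selector m \<alpha> u \<beta> \<longleftrightarrow>
     \<beta> \<in> policies m \<and>
     (\<forall>x. is_arg_min (DCOE_action m u x) (\<lambda>a. a \<in> actions m) (\<beta> x) \<and>
          \<alpha> * u x = DCOE_action m u x (\<beta> x))"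

text \<open>Cluster points with respect to the product topology, i.e. the library topology on functions.\<close>

definition seq_limit_point :: "(nat \<Rightarrow> policy) \<Rightarrow> policy \<Rightarrow> bool" where
  "seq_limit_point \<beta>s \<beta> \<longleftrightarrow>
     (\<forall>U. open U \<and> \<beta> \<in> U \<longrightarrow> (\<exists>\<^sub>F k in sequentially. \<beta>s k \<in> U))"

end

theory Submission
  imports Defs
begin

text \<open>
  All transition rates are bounded by the total rate \<open>\<Lambda>\<close>, so the chain of a stationary policy \<open>\<beta>\<close> can be
  analysed through its uniformised jump chain. Let \<open>T\<^sub>\<beta>\<close> be the operator \<open>T\<close> with the minimising action
  replaced by the action of \<open>\<beta>\<close>. The central fact is that the discounted cost of \<open>\<beta>\<close> is the
  increasing limit of the iterates of \<open>T\<^sub>\<beta>\<close> started in \<open>0\<close> (\<open>discounted_cost_eq_SUP\<close>).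

  It is proved in two steps. Since the cost is nonnegative and a right-continuous path in a discrete space has
  only countably many discontinuities, Tonelli's theorem writes the discounted cost as the sum over
  all states \<open>y\<close> of the cost rate in \<open>y\<close> times the resolvent \<open>\<integral> exp (- \<alpha> t) p\<^sub>t(x, y) dt\<close>
  (\<open>expected_cost_eq_resolvent\<close>). The backward equation for \<open>p\<^sub>t\<close>, which involves finite sums only,
  shows that the resolvent is a bounded solution of the fixed point equation with a point cost at \<open>y\<close>.
  There the iteration is a contraction, so the iterates converge to the resolvent; the iterates for a general
  nonnegative cost are superpositions of these (\<open>SUP_cost_iter\<close>).

  The rest is monotone dynamic programming. The weight function yields a supersolution of \<open>T\<close>
  (\<open>supersolution\<close>), which bounds the nondecreasing sequence \<open>u\<^sub>k\<close>; its limit \<open>u\<close> is a fixed point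
  of \<open>T\<close> because \<open>T\<close> is a minimum of two affine functions of finitely many values. The iterates of \<open>T\<^sub>\<beta>\<close> dominate
  \<open>u\<^sub>k\<close>, so no policy costs less than \<open>u\<close> (\<open>discounted_cost_ge\<close>). If \<open>\<beta>\<close> attains the minimum in
  \<open>u = T u\<close>, then \<open>u\<close> is a fixed point of \<open>T\<^sub>\<beta>\<close> and dominates its iterates, so \<open>\<beta>\<close> costs at most \<open>u\<close>
  (\<open>discounted_cost_le\<close>). Limit points of the minimisers \<open>\<beta>\<^sub>k\<close> attain the minimum by continuity
  (\<open>limit_point_attains\<close>).
\<close>

section \<open>Transition rates and the one-step operator\<close>

text \<open>
  A finite set containing \<open>x\<close> and every state that a transition from \<open>x\<close> can reach. When \<open>x\<close> lies on
  the boundary of the quadrant, it may contain further states, some of them produced by the truncated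
  subtraction; the jump rates to them vanish.
\<close>

definition nbhd :: "state \<Rightarrow> state set" where
  "nbhd x = {x, (fst x, Suc (snd x)), (Suc (fst x), snd x), (fst x - 1, snd x - 1)}"

lemma finite_nbhd [simp]: "finite (nbhd x)"
  by (simp add: nbhd_def)

lemma self_in_nbhd [simp]: "x \<in> nbhd x"
  by (simp add: nbhd_def)

lemma jump_rate_self [simp]: "jump_rate m a x x = 0"
  by (cases x) auto

lemma jump_rate_outside: "y \<notin> nbhd x \<Longrightarrow> jump_rate m a x y = 0"
  by (cases x; cases y) (auto simp: nbhd_def)

lemma jump_rate_nonneg: "valid_model m \<Longrightarrow> 0 \<le> a \<Longrightarrow> 0 \<le> jump_rate m a x y"
  by (cases x; cases y) (auto simp: valid_model_def)

lemma jump_rate_affine: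
  "jump_rate m a x y = jump_rate m 0 x y + a * of_bool (y = (fst x, Suc (snd x)))"
  by (cases x; cases y) auto

lemma rate_self: "rate m a x x = - (\<Sum>y\<in>nbhd x. jump_rate m a x y)"
proof -
  have "(\<Sum>\<^sub>\<infinity>z\<in>UNIV - {x}. jump_rate m a x z) = (\<Sum>\<^sub>\<infinity>z\<in>nbhd x. jump_rate m a x z)"
    by (rule infsum_cong_neutral) (auto simp: jump_rate_outside)
  then show ?thesis by (simp add: rate_def)
qed

lemma rate_other: "x \<noteq> y \<Longrightarrow> rate m a x y = jump_rate m a x y"
  by (simp add: rate_def)

lemma rate_outside: "y \<notin> nbhd x \<Longrightarrow> rate m a x y = 0"
  using jump_rate_outside rate_other self_in_nbhd by metis

lemma sum_rate: "(\<Sum>y\<in>nbhd x. rate m a x y) = 0"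
proof -
  have "(\<Sum>y\<in>nbhd x. rate m a x y) = rate m a x x + (\<Sum>y\<in>nbhd x - {x}. rate m a x y)"
    by (rule sum.remove) auto
  also have "(\<Sum>y\<in>nbhd x - {x}. rate m a x y) = (\<Sum>y\<in>nbhd x - {x}. jump_rate m a x y)"
    by (rule sum.cong) (auto simp: rate_other)
  also have "\<dots> = (\<Sum>y\<in>nbhd x. jump_rate m a x y)"
    by (rule sum.mono_neutral_left) auto
  finally show ?thesis by (simp add: rate_self)
qed

text \<open>
  Rates and costs are affine in the production rate, and hence so is \<^const>\<open>T_action\<close>. The infimum over
  the action interval is therefore attained at one of its two endpoints (lemma \<open>T_op_eq\<close>), and no
  compactness argument is needed for the existence of minimising actions or for the passage to
  the limit in \<open>u\<^sub>k\<^sub>+\<^sub>1 = T u\<^sub>k\<close>.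
\<close>

lemma rate_affine:
  "rate m a x y = rate m 0 x y + a * (of_bool (y = (fst x, Suc (snd x))) - of_bool (y = x))"
proof (cases "x = y")
  case False
  then show ?thesis
    using jump_rate_affine[of m a x y] by (simp add: rate_other)
next
  case True
  have "(\<Sum>z\<in>nbhd x. jump_rate m a x z)
      = (\<Sum>z\<in>nbhd x. jump_rate m 0 x z + a * of_bool (z = (fst x, Suc (snd x))))"
    by (rule sum.cong[OF refl], rule jump_rate_affine)
  also have "\<dots> = (\<Sum>z\<in>nbhd x. jump_rate m 0 x z)
      + a * (\<Sum>z\<in>nbhd x. of_bool (z = (fst x, Suc (snd x))))"
    by (simp add: sum.distrib sum_distrib_left)
  also have "(\<Sum>z\<in>nbhd x. of_bool (z = (fst x, Suc (snd x)))) = (1::real)"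
  proof -
    have "(\<Sum>z\<in>nbhd x. of_bool (z = (fst x, Suc (snd x))) :: real)
        = (\<Sum>z\<in>nbhd x. if z = (fst x, Suc (snd x)) then 1 else 0)"
      by (rule sum.cong) auto
    also have "\<dots> = 1" by (subst sum.delta) (auto simp: nbhd_def)
    finally show ?thesis .
  qed
  finally have e: "(\<Sum>z\<in>nbhd x. jump_rate m a x z) = (\<Sum>z\<in>nbhd x. jump_rate m 0 x z) + a" by simp
  have "x \<noteq> (fst x, Suc (snd x))" by (cases x) auto
  with True e show ?thesis by (simp add: rate_self)
qed

lemma exit_rate_le:
  assumes "valid_model m" "a \<in> actions m"
  shows "- rate m a x x \<le> total_rate m"
proof -
  obtain n i where x: "x = (n, i)" by (cases x)
  have pos: "0 < arrival m" "0 < service m" "0 \<le> a" "a \<le> max_prod m"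
    using assms by (auto simp: valid_model_def actions_def)
  have "(\<Sum>y\<in>nbhd x. jump_rate m a x y)
      \<le> (\<Sum>y\<in>nbhd x. (if y = (n, Suc i) then a else 0) + (if y = (Suc n, i) then arrival m else 0)
           + (if y = (n - 1, i - 1) then service m else 0))"
    by (rule sum_mono) (use pos in \<open>auto simp: x nbhd_def\<close>)
  also have "\<dots> = a + arrival m + service m"
    by (simp add: sum.distrib x nbhd_def)
  finally show ?thesis
    using pos by (simp add: rate_self total_rate_def)
qed

lemma infsum_rate: "(\<Sum>\<^sub>\<infinity>y. rate m a x y * u y) = (\<Sum>y\<in>nbhd x. rate m a x y * u y)"
proof -
  have "(\<Sum>\<^sub>\<infinity>y. rate m a x y * u y) = (\<Sum>\<^sub>\<infinity>y\<in>nbhd x. rate m a x y * u y)"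
    by (rule infsum_cong_neutral) (auto simp: rate_outside)
  then show ?thesis by simp
qed

lemma infsum_unif_prob:
  "(\<Sum>\<^sub>\<infinity>y. unif_prob m a x y * u y) = (\<Sum>y\<in>nbhd x. unif_prob m a x y * u y)"
proof -
  have "(\<Sum>\<^sub>\<infinity>y. unif_prob m a x y * u y) = (\<Sum>\<^sub>\<infinity>y\<in>nbhd x. unif_prob m a x y * u y)"
    by (rule infsum_cong_neutral) (auto simp: rate_outside unif_prob_def kdelta_def)
  then show ?thesis by simp
qed

lemma sum_kdelta [simp]:
  assumes "finite A" "x \<in> A"
  shows "(\<Sum>y\<in>A. kdelta x y * u y) = u x"
proof -
  have "(\<Sum>y\<in>A. kdelta x y * u y) = (\<Sum>y\<in>A. if x = y then u y else 0)"
    by (rule sum.cong) (auto simp: kdelta_def)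
  also have "\<dots> = u x" using assms by (subst sum.delta') auto
  finally show ?thesis .
qed

lemma total_rate_pos: "valid_model m \<Longrightarrow> 0 < total_rate m"
  by (auto simp: valid_model_def total_rate_def)

lemma cost_nonneg: "valid_model m \<Longrightarrow> a \<in> actions m \<Longrightarrow> 0 \<le> cost m x a"
  by (cases x) (auto simp: valid_model_def actions_def)

lemma cost_affine: "cost m x a = cost m x 0 + a * (cost_prod m * of_bool (snd x > threshold m))"
  by (cases x) auto

text \<open>
  The weights \<open>rate m a x y + \<Lambda> * kdelta x y\<close>, where \<open>\<Lambda>\<close> is the total rate, are nonnegative and add up to \<open>\<Lambda>\<close> over
  the neighbourhood of \<open>x\<close>.
\<close>

lemma T_action_eq:
  assumes "valid_model m" "\<alpha> > 0"
  shows "T_action m \<alpha> u x a =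
    (cost m x a + (\<Sum>y\<in>nbhd x. (rate m a x y + total_rate m * kdelta x y) * u y)) / (total_rate m + \<alpha>)"
proof -
  have L: "total_rate m > 0" by (rule total_rate_pos[OF assms(1)])
  have "total_rate m * (\<Sum>y\<in>nbhd x. unif_prob m a x y * u y)
      = (\<Sum>y\<in>nbhd x. (rate m a x y + total_rate m * kdelta x y) * u y)"
    unfolding sum_distrib_left
    by (rule sum.cong) (use L in \<open>auto simp: unif_prob_def field_simps\<close>)
  then show ?thesis
    unfolding T_action_def infsum_unif_prob by (simp add: add_divide_distrib)
qed

lemma T_action_DCOE_action:
  assumes "valid_model m" "\<alpha> > 0"
  shows "T_action m \<alpha> u x a = (DCOE_action m u x a + total_rate m * u x) / (total_rate m + \<alpha>)"
proof -
  have "(\<Sum>y\<in>nbhd x. (rate m a x y + total_rate m * kdelta x y) * u y)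
     = (\<Sum>y\<in>nbhd x. rate m a x y * u y) + total_rate m * (\<Sum>y\<in>nbhd x. kdelta x y * u y)"
    by (simp add: distrib_right sum.distrib sum_distrib_left mult.assoc del: sum_kdelta)
  then show ?thesis
    unfolding T_action_eq[OF assms] DCOE_action_def infsum_rate by simp
qed

lemma unif_rate_nonneg:
  assumes "valid_model m" "a \<in> actions m"
  shows "0 \<le> rate m a x y + total_rate m * kdelta x y"
proof (cases "x = y")
  case True
  then show ?thesis using exit_rate_le[OF assms, of y] by (simp add: kdelta_def)
next
  case False
  have "0 \<le> a" using assms by (auto simp: valid_model_def actions_def)
  with False show ?thesis
    using jump_rate_nonneg[OF assms(1)] by (simp add: kdelta_def rate_other)
qed

lemma T_action_mono:
  assumes "valid_model m" "\<alpha> > 0" "a \<in> actions m" "\<And>y. u y \<le> v y"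
  shows "T_action m \<alpha> u x a \<le> T_action m \<alpha> v x a"
  unfolding T_action_eq[OF assms(1,2)]
  by (intro divide_right_mono add_left_mono sum_mono mult_left_mono unif_rate_nonneg assms)
     (use total_rate_pos[OF assms(1)] assms(2) in auto)

text \<open>
  The coefficient of the production rate in \<^const>\<open>T_action\<close>.
\<close>

definition T_slope :: "inventory_model \<Rightarrow> real \<Rightarrow> (state \<Rightarrow> real) \<Rightarrow> state \<Rightarrow> real" where
  "T_slope m \<alpha> u x =
     (cost_prod m * of_bool (snd x > threshold m) + u (fst x, Suc (snd x)) - u x) / (total_rate m + \<alpha>)"

lemma T_action_affine:
  assumes "valid_model m" "\<alpha> > 0"
  shows "T_action m \<alpha> u x a = T_action m \<alpha> u x 0 + a * T_slope m \<alpha> u x"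
proof -
  let ?up = "(fst x, Suc (snd x))"
  have "(\<Sum>y\<in>nbhd x. rate m a x y * u y)
    = (\<Sum>y\<in>nbhd x. rate m 0 x y * u y + a * ((if y = ?up then u y else 0) - (if y = x then u y else 0)))"
  proof (rule sum.cong[OF refl])
    fix y
    show "rate m a x y * u y
      = rate m 0 x y * u y + a * ((if y = ?up then u y else 0) - (if y = x then u y else 0))"
      by (subst rate_affine) (simp add: distrib_right)
  qed
  also have "\<dots> = (\<Sum>y\<in>nbhd x. rate m 0 x y * u y) + a * (u ?up - u x)"
    unfolding sum.distrib sum_distrib_left[symmetric] sum_subtractf
    by (subst (1 2) sum.delta) (auto simp: nbhd_def)
  finally have "DCOE_action m u x a = DCOE_action m u x 0
      + a * (cost_prod m * of_bool (snd x > threshold m) + u ?up - u x)"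
    using cost_affine[of m x a] unfolding DCOE_action_def infsum_rate by (simp add: algebra_simps)
  then show ?thesis
    unfolding T_action_DCOE_action[OF assms] T_slope_def
    by (simp add: add_divide_distrib)
qed

lemma affine_ge_min:
  fixes p s a b c :: real
  assumes "a \<le> b" "b \<le> c"
  shows "min (p + a * s) (p + c * s) \<le> p + b * s"
proof (cases "0 \<le> s")
  case True
  then show ?thesis using mult_right_mono[OF assms(1) True] by linarith
next
  case False
  then have "c * s \<le> b * s" using assms by (intro mult_right_mono_neg) auto
  then show ?thesis by linarith
qed

lemma T_action_ge_endpoints:
  assumes "valid_model m" "\<alpha> > 0" "a \<in> actions m"
  shows "min (T_action m \<alpha> u x (min_prod m)) (T_action m \<alpha> u x (max_prod m)) \<le> T_action m \<alpha> u x a"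
proof -
  note aff = T_action_affine[OF assms(1,2), of u x]
  have "min_prod m \<le> a" "a \<le> max_prod m" using assms(3) by (auto simp: actions_def)
  then show ?thesis
    unfolding aff[of a] aff[of "min_prod m"] aff[of "max_prod m"] by (rule affine_ge_min)
qed

lemma T_op_eq:
  assumes "valid_model m" "\<alpha> > 0"
  shows "T_op m \<alpha> u x = min (T_action m \<alpha> u x (min_prod m)) (T_action m \<alpha> u x (max_prod m))"
  unfolding T_op_def
proof (rule cInf_eq_minimum)
  have "min_prod m \<in> actions m" "max_prod m \<in> actions m"
    using assms(1) by (auto simp: valid_model_def actions_def)
  then show "min (T_action m \<alpha> u x (min_prod m)) (T_action m \<alpha> u x (max_prod m))
      \<in> T_action m \<alpha> u x ` actions m"
    by (auto simp: min_def)
  fix v assume "v \<in> T_action m \<alpha> u x ` actions m"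
  then obtain a where a: "a \<in> actions m" "v = T_action m \<alpha> u x a" by auto
  show "min (T_action m \<alpha> u x (min_prod m)) (T_action m \<alpha> u x (max_prod m)) \<le> v"
    using T_action_ge_endpoints[OF assms a(1)] by (simp only: a(2))
qed

lemma T_op_le:
  assumes "valid_model m" "\<alpha> > 0" "a \<in> actions m"
  shows "T_op m \<alpha> u x \<le> T_action m \<alpha> u x a"
  using T_action_ge_endpoints[OF assms] by (simp only: T_op_eq[OF assms(1,2)])

lemma T_op_attained:
  assumes "valid_model m" "\<alpha> > 0"
  obtains a where "a \<in> actions m" "T_op m \<alpha> u x = T_action m \<alpha> u x a"
proof -
  have "min_prod m \<in> actions m" "max_prod m \<in> actions m"
    using assms(1) by (auto simp: valid_model_def actions_def)
  then show thesis using that T_op_eq[OF assms, of u x] by (metis min_def)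
qed

lemma T_op_mono:
  assumes "valid_model m" "\<alpha> > 0" "\<And>y. u y \<le> v y"
  shows "T_op m \<alpha> u x \<le> T_op m \<alpha> v x"
proof -
  obtain a where a: "a \<in> actions m" "T_op m \<alpha> v x = T_action m \<alpha> v x a"
    using T_op_attained[OF assms(1,2)] .
  have "T_op m \<alpha> u x \<le> T_action m \<alpha> u x a" by (rule T_op_le[OF assms(1,2) a(1)])
  also have "\<dots> \<le> T_action m \<alpha> v x a" by (rule T_action_mono[OF assms(1,2) a(1) assms(3)])
  finally show ?thesis using a by simp
qed

section \<open>Transition functions with bounded rates\<close>

text \<open>
  A transition function \<open>p\<close> whose rates \<open>q\<close> at time \<open>0\<close> are conservative, with each row carried by the finite
  set \<open>N x\<close>, and bounded: nonnegativity of the uniformised weights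
  \<open>q x y + L \<delta>\<close> says that no state is left at a rate above \<open>L\<close>. That the other entries of a row vanish is not
  required separately, since the entries in \<open>N x\<close> already sum to \<open>0\<close>.
\<close>

locale bounded_generator =
  fixes p :: "real \<Rightarrow> state \<Rightarrow> state \<Rightarrow> real" and q :: "state \<Rightarrow> state \<Rightarrow> real"
    and N :: "state \<Rightarrow> state set" and L :: real
  assumes tf: "transition_function p"
    and deriv_0: "((\<lambda>t. p t x y) has_real_derivative q x y) (at 0 within {0..})"
    and fin_N [simp]: "finite (N x)"
    and self_N [simp]: "x \<in> N x"
    and conservative: "(\<Sum>z\<in>N x. q x z) = 0"
    and unif_nonneg: "0 \<le> q x y + L * kdelta x y"
    and L_pos: "0 < L"
begin

lemma p_zero: "p 0 x y = kdelta x y"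
  using tf unfolding transition_function_def by blast

lemma p_nonneg: "0 \<le> t \<Longrightarrow> 0 \<le> p t x y"
  using tf unfolding transition_function_def by blast

lemma p_total: "0 \<le> t \<Longrightarrow> (p t x has_sum 1) UNIV"
  using tf unfolding transition_function_def by blast

lemma p_semigroup: "0 \<le> s \<Longrightarrow> 0 \<le> t \<Longrightarrow> ((\<lambda>z. p s x z * p t z y) has_sum p (s + t) x y) UNIV"
  using tf unfolding transition_function_def by blast

lemma p_sum_le_1: "0 \<le> t \<Longrightarrow> finite A \<Longrightarrow> sum (p t x) A \<le> 1"
  by (rule has_sum_mono'[OF has_sum_finite p_total]) (auto simp: p_nonneg)

lemma p_le_1: "0 \<le> t \<Longrightarrow> p t x y \<le> 1"
  using p_sum_le_1[of t "{y}" x] by simp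

lemma sum_N_kdelta: "(\<Sum>z\<in>N x. kdelta x z * u z) = u x"
  by (rule sum_kdelta[OF fin_N self_N])

lemma unif_sum: "(\<Sum>z\<in>N x. q x z + L * kdelta x z) = L"
  using sum_N_kdelta[of x "\<lambda>_. L"] conservative[of x]
  by (simp add: sum.distrib mult.commute)

text \<open>
  Chapman--Kolmogorov with the intermediate state restricted to a finite set \<open>A\<close>: the error is at most the
  probability of being outside \<open>A\<close>. With \<open>A = {x}\<close> this gives continuity in time, and with
  \<open>A = N x\<close> the backward equation.
\<close>

lemma p_split:
  assumes "0 \<le> h" "0 \<le> s" "finite A"
  shows "(\<Sum>z\<in>A. p h x z * p s z y) \<le> p (h + s) x y"
    and "p (h + s) x y \<le> (\<Sum>z\<in>A. p h x z * p s z y) + (1 - sum (p h x) A)"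
proof -
  have r1: "((\<lambda>z. p h x z * p s z y) has_sum (p (h + s) x y - (\<Sum>z\<in>A. p h x z * p s z y))) (UNIV - A)"
    by (rule has_sum_Diff[OF p_semigroup has_sum_finite]) (use assms in auto)
  have r2: "(p h x has_sum (1 - sum (p h x) A)) (UNIV - A)"
    by (rule has_sum_Diff[OF p_total has_sum_finite]) (use assms in auto)
  have "0 \<le> p (h + s) x y - (\<Sum>z\<in>A. p h x z * p s z y)"
    by (rule has_sum_nonneg[OF r1]) (use assms in \<open>auto intro!: mult_nonneg_nonneg p_nonneg\<close>)
  then show "(\<Sum>z\<in>A. p h x z * p s z y) \<le> p (h + s) x y" by simp
  have "p (h + s) x y - (\<Sum>z\<in>A. p h x z * p s z y) \<le> 1 - sum (p h x) A"
    by (rule has_sum_mono[OF r1 r2]) (use assms in \<open>auto intro!: mult_left_le p_nonneg p_le_1\<close>)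
  then show "p (h + s) x y \<le> (\<Sum>z\<in>A. p h x z * p s z y) + (1 - sum (p h x) A)" by simp
qed

lemma p_increment:
  assumes "0 \<le> s" "0 \<le> t"
  shows "\<bar>p s x y - p t x y\<bar> \<le> 1 - p \<bar>s - t\<bar> x x"
proof -
  have *: "\<bar>p (h + r) x y - p r x y\<bar> \<le> 1 - p h x x" if "0 \<le> h" "0 \<le> r" for h r
  proof -
    have a: "p h x x * p r x y \<le> p (h + r) x y"
      using p_split(1)[OF that, of "{x}" x y] by simp
    have b: "p (h + r) x y \<le> p h x x * p r x y + (1 - p h x x)"
      using p_split(2)[OF that, of "{x}" x y] by simp
    have c: "p h x x * p r x y \<le> p r x y"
      using p_le_1[OF that(1), of x x] p_nonneg[OF that(2), of x y] by (simp add: mult_left_le_one_le p_nonneg that)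
    have "(1 - p h x x) * p r x y \<le> 1 - p h x x"
      by (rule mult_left_le) (use p_le_1 that in auto)
    with a b c show ?thesis by (simp add: abs_le_iff algebra_simps)
  qed
  show ?thesis
  proof (cases "s \<le> t")
    case True
    with *[of "t - s" s] assms show ?thesis by (simp add: abs_minus_commute)
  next
    case False
    with *[of "s - t" t] assms show ?thesis by simp
  qed
qed

lemma tendsto_p_0: "((\<lambda>h. p h x y) \<longlongrightarrow> kdelta x y) (at 0 within {0..})"
proof -
  have "continuous (at 0 within {0..}) (\<lambda>h. p h x y)"
    by (rule DERIV_continuous[OF deriv_0])
  then show ?thesis by (simp add: continuous_within p_zero)
qed

lemma continuous_on_p: "continuous_on {0..} (\<lambda>t. p t x y)"
  unfolding continuous_on_def
proof
  fix t :: real assume t: "t \<in> {0..}"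
  have "((\<lambda>s. \<bar>s - t\<bar>) \<longlongrightarrow> 0) (at t within {0..})"
    by (rule tendsto_eq_intros | simp)+
  then have f: "filterlim (\<lambda>s. \<bar>s - t\<bar>) (at 0 within {0..}) (at t within {0..})"
    by (auto simp: filterlim_at eventually_at_filter)
  have l: "((\<lambda>s. 1 - p \<bar>s - t\<bar> x x) \<longlongrightarrow> 0) (at t within {0..})"
    using tendsto_diff[OF tendsto_const[of 1] filterlim_compose[OF tendsto_p_0[of x x] f]]
    by (simp add: kdelta_def)
  have "((\<lambda>s. p s x y - p t x y) \<longlongrightarrow> 0) (at t within {0..})"
  proof (rule Lim_null_comparison[OF _ l])
    show "\<forall>\<^sub>F s in at t within {0..}. norm (p s x y - p t x y) \<le> 1 - p \<bar>s - t\<bar> x x"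
      using p_increment t by (auto simp: eventually_at_filter)
  qed
  then show "((\<lambda>s. p s x y) \<longlongrightarrow> p t x y) (at t within {0..})"
    by (simp add: LIM_zero_iff)
qed

lemma isCont_p: "0 < t \<Longrightarrow> isCont (\<lambda>t. p t x y) t"
  using continuous_on_interior[OF continuous_on_p, of t] by simp

lemma difference_quotient_0: "((\<lambda>h. (p h x y - kdelta x y) / h) \<longlongrightarrow> q x y) (at_right 0)"
proof -
  have "((\<lambda>h. (p h x y - kdelta x y) / h) \<longlongrightarrow> q x y) (at 0 within {0..})"
    using deriv_0[of x y] by (simp add: has_field_derivative_iff p_zero)
  then show ?thesis by (rule tendsto_within_subset) auto
qed

text \<open>
  The two-sided difference quotient at \<open>t\<close> between \<open>s\<close> and \<open>t\<close> is an increment over a time step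
  \<open>\<bar>s - t\<bar>\<close> that starts from \<open>min s t\<close>, which treats left and right derivatives at once.
\<close>

lemma backward_equation:
  assumes t: "0 < t"
  shows "((\<lambda>t. p t x y) has_real_derivative (\<Sum>z\<in>N x. q x z * p t z y)) (at t)"
  unfolding has_field_derivative_iff
proof -
  define \<sigma> where "\<sigma> = (\<lambda>s. min s t)"
  define k where "k = (\<lambda>s. \<bar>s - t\<bar>)"
  define lo where "lo = (\<lambda>s. \<Sum>z\<in>N x. (p (k s) x z - kdelta x z) / k s * p (\<sigma> s) z y)"
  define err where "err = (\<lambda>s. - (\<Sum>z\<in>N x. (p (k s) x z - kdelta x z) / k s))"
  have "(k \<longlongrightarrow> 0) (at t)"
    unfolding k_def by (rule tendsto_eq_intros | simp)+
  then have k: "filterlim k (at_right 0) (at t)"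
    by (auto simp: filterlim_at eventually_at_filter k_def)
  have "(\<sigma> \<longlongrightarrow> t) (at t)"
    unfolding \<sigma>_def by (rule tendsto_eq_intros | simp)+
  then have \<sigma>: "((\<lambda>s. p (\<sigma> s) z y) \<longlongrightarrow> p t z y) (at t)" for z
    using isCont_tendsto_compose[OF isCont_p[OF t]] by blast
  \<comment> \<open>By conservativity, the probability of leaving \<open>N x\<close> is of smaller order than the time step.\<close>
  have dq: "((\<lambda>s. (p (k s) x z - kdelta x z) / k s) \<longlongrightarrow> q x z) (at t)" for z
    by (rule filterlim_compose[OF difference_quotient_0 k])
  have lo: "(lo \<longlongrightarrow> (\<Sum>z\<in>N x. q x z * p t z y)) (at t)"
    unfolding lo_def by (intro tendsto_sum tendsto_mult dq \<sigma>)
  have "(err \<longlongrightarrow> - (\<Sum>z\<in>N x. q x z)) (at t)"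
    unfolding err_def by (intro tendsto_sum tendsto_minus dq)
  then have hi: "((\<lambda>s. lo s + err s) \<longlongrightarrow> (\<Sum>z\<in>N x. q x z * p t z y)) (at t)"
    using tendsto_add[OF lo \<open>(err \<longlongrightarrow> - (\<Sum>z\<in>N x. q x z)) (at t)\<close>] by (simp add: conservative)
  have bounds: "lo s \<le> (p s x y - p t x y) / (s - t) \<and> (p s x y - p t x y) / (s - t) \<le> lo s + err s"
    if s: "0 < s" "s \<noteq> t" for s
  proof -
    have kp: "0 < k s" and sp: "0 \<le> \<sigma> s" using s t by (auto simp: k_def \<sigma>_def)
    have eq: "(p s x y - p t x y) / (s - t) = (p (k s + \<sigma> s) x y - p (\<sigma> s) x y) / k s"
      using s by (cases "s < t") (auto simp: k_def \<sigma>_def min_def divide_simps algebra_simps)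
    have lo_eq: "lo s = ((\<Sum>z\<in>N x. p (k s) x z * p (\<sigma> s) z y) - p (\<sigma> s) x y) / k s"
    proof -
      have "lo s = (\<Sum>z\<in>N x. (p (k s) x z * p (\<sigma> s) z y - kdelta x z * p (\<sigma> s) z y)) / k s"
        unfolding lo_def sum_divide_distrib
        by (rule sum.cong) (auto simp: field_simps)
      then show ?thesis by (simp add: sum_subtractf sum_N_kdelta)
    qed
    have err_eq: "err s = (1 - sum (p (k s) x) (N x)) / k s"
    proof -
      have "(\<Sum>z\<in>N x. kdelta x z) = 1" using sum_N_kdelta[of x "\<lambda>_. 1"] by simp
      then show ?thesis
        unfolding err_def sum_divide_distrib[symmetric] by (simp add: sum_subtractf diff_divide_distrib)
    qed
    show ?thesis
      unfolding eq lo_eq err_eq add_divide_distrib[symmetric]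
      using p_split[OF less_imp_le[OF kp] sp fin_N[of x], where x = x and y = y] kp
      by (auto intro!: divide_right_mono)
  qed
  have ev: "\<forall>\<^sub>F s in at t. 0 < s \<and> s \<noteq> t"
  proof -
    have "\<forall>\<^sub>F s in nhds t. s \<in> {0<..}" by (rule eventually_nhds_in_open) (use t in auto)
    then show ?thesis by (auto simp: eventually_at_filter elim: eventually_mono)
  qed
  show "((\<lambda>s. (p s x y - p t x y) / (s - t)) \<longlongrightarrow> (\<Sum>z\<in>N x. q x z * p t z y)) (at t)"
    by (rule tendsto_sandwich[OF _ _ lo hi]) (use ev bounds in \<open>auto elim: eventually_mono\<close>)
qed

text \<open>
  The Laplace transform of the transition function: the expected discounted time spent in \<open>y\<close> when
  the chain starts in \<open>x\<close>.
\<close>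

definition resolvent :: "real \<Rightarrow> state \<Rightarrow> state \<Rightarrow> real" where
  "resolvent \<alpha> x y = (LINT t:{0<..}|lborel. exp (- \<alpha> * t) * p t x y)"

lemma set_integrable_exp: "\<alpha> > 0 \<Longrightarrow> set_integrable lborel {0<..} (\<lambda>t::real. exp (- \<alpha> * t))"
  using integrable_I0i_exp_mscale[of \<alpha>] by (simp add: mult.commute)

lemma set_integrable_discounted:
  assumes "\<alpha> > 0"
  shows "set_integrable lborel {0<..} (\<lambda>t. exp (- \<alpha> * t) * p t x y)"
proof (rule set_integrable_bound[OF set_integrable_exp[OF assms]])
  have "continuous_on {0<..} (\<lambda>t. exp (- \<alpha> * t) * p t x y)"
    by (intro continuous_intros continuous_on_subset[OF continuous_on_p]) auto
  then show "set_borel_measurable lborel {0<..} (\<lambda>t. exp (- \<alpha> * t) * p t x y)"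
    using borel_measurable_continuous_on_indicator[of "{0<..}" "\<lambda>t. exp (- \<alpha> * t) * p t x y"]
    by (simp add: set_borel_measurable_def)
  show "AE t in lborel. t \<in> {0<..} \<longrightarrow> norm (exp (- \<alpha> * t) * p t x y) \<le> norm (exp (- \<alpha> * t))"
    using p_nonneg p_le_1 by (auto simp: abs_mult intro!: mult_left_le)
qed

lemma resolvent_nonneg: "0 \<le> resolvent \<alpha> x y"
  unfolding resolvent_def set_lebesgue_integral_def
  by (rule Bochner_Integration.integral_nonneg) (auto simp: indicator_def p_nonneg)

lemma resolvent_le:
  assumes "\<alpha> > 0"
  shows "resolvent \<alpha> x y \<le> 1 / \<alpha>"
proof -
  have "resolvent \<alpha> x y \<le> (LINT t:{0<..}|lborel. exp (- \<alpha> * t))"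
    unfolding resolvent_def
    by (rule set_integral_mono[OF set_integrable_discounted[OF assms] set_integrable_exp[OF assms]])
       (use p_nonneg p_le_1 in \<open>auto intro!: mult_left_le\<close>)
  also have "\<dots> = 1 / \<alpha>"
    using LBINT_I0i_exp_mscale[OF assms]
    by (simp add: interval_lebesgue_integral_0_infty mult.commute)
  finally show ?thesis .
qed

text \<open>
  The backward equation integrated against the discount factor: \<open>exp (- \<alpha> t) * p t x y\<close> falls from
  \<open>kdelta x y\<close> at \<open>0\<close> to \<open>0\<close> at infinity.
\<close>

lemma resolvent_equation:
  assumes "\<alpha> > 0"
  shows "\<alpha> * resolvent \<alpha> x y = kdelta x y + (\<Sum>z\<in>N x. q x z * resolvent \<alpha> z y)"
proof -
  define F where "F = (\<lambda>t. exp (- \<alpha> * t) * p t x y)"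
  define f where "f = (\<lambda>t. (\<Sum>z\<in>N x. q x z * (exp (- \<alpha> * t) * p t z y)) - \<alpha> * F t)"
  have int: "set_integrable lborel {0<..} (\<lambda>t. exp (- \<alpha> * t) * p t z y)" for z
    by (rule set_integrable_discounted[OF assms])
  have qint: "integrable lborel (\<lambda>t. indicator {0<..} t *\<^sub>R (q x z * (exp (- \<alpha> * t) * p t z y)))" for z
    using set_integrable_mult_right[of "q x z", OF int] unfolding set_integrable_def .
  have ints: "set_integrable lborel {0<..} (\<lambda>t. \<Sum>z\<in>N x. q x z * (exp (- \<alpha> * t) * p t z y))"
    unfolding set_integrable_def scaleR_sum_right
    by (intro Bochner_Integration.integrable_sum qint)
  have intf: "set_integrable lborel {0<..} f"
    unfolding f_def F_def
    by (intro set_integral_diff ints set_integrable_mult_right int)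
  have "(LBINT t=0..\<infinity>. f t) = 0 - kdelta x y"
  proof (rule interval_integral_FTC_integrable)
    fix t :: real assume "0 < ereal t"
    then have t: "0 < t" by simp
    have "(F has_real_derivative f t) (at t)"
      unfolding F_def f_def
      by (rule derivative_eq_intros backward_equation[OF t] refl | simp)+
         (simp add: sum_distrib_left algebra_simps)
    then show "(F has_vector_derivative f t) (at t)"
      by (simp add: has_real_derivative_iff_has_vector_derivative)
    show "isCont f t"
      unfolding f_def F_def by (intro continuous_intros isCont_p t)
  next
    show "set_integrable lborel (einterval 0 \<infinity>) f"
      using intf by (simp add: zero_ereal_def)
    have "((\<lambda>t. p t x y) \<longlongrightarrow> kdelta x y) (at_right 0)"
      by (rule tendsto_within_subset[OF tendsto_p_0]) auto
    then have "(F \<longlongrightarrow> exp (- \<alpha> * 0) * kdelta x y) (at_right 0)"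
      unfolding F_def by (intro tendsto_intros)
    then show "((F \<circ> real_of_ereal) \<longlongrightarrow> kdelta x y) (at_right 0)"
      by (simp add: zero_ereal_def ereal_tendsto_simps)
    have e: "((\<lambda>t. exp (- \<alpha> * t)) \<longlongrightarrow> 0) at_top"
      using assms by real_asymp
    have "(F \<longlongrightarrow> 0) at_top"
    proof (rule Lim_null_comparison[OF _ e])
      show "\<forall>\<^sub>F t in at_top. norm (F t) \<le> exp (- \<alpha> * t)"
        using eventually_ge_at_top[of 0]
        by eventually_elim (auto simp: F_def abs_mult p_nonneg p_le_1 intro!: mult_left_le)
    qed
    then show "((F \<circ> real_of_ereal) \<longlongrightarrow> 0) (at_left \<infinity>)"
      by (simp add: ereal_tendsto_simps)
  qed simp
  moreover have "(LBINT t=0..\<infinity>. f t) = (\<Sum>z\<in>N x. q x z * resolvent \<alpha> z y) - \<alpha> * resolvent \<alpha> x y"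
  proof -
    have "(LINT t:{0<..}|lborel. (\<Sum>z\<in>N x. q x z * (exp (- \<alpha> * t) * p t z y)))
        = (\<Sum>z\<in>N x. q x z * resolvent \<alpha> z y)"
      unfolding set_lebesgue_integral_def scaleR_sum_right
      by (subst Bochner_Integration.integral_sum[OF qint])
         (simp only: set_lebesgue_integral_def[symmetric] set_integral_mult_right resolvent_def)
    then show ?thesis
      unfolding interval_lebesgue_integral_0_infty f_def F_def
      by (subst set_integral_diff(2)[OF ints]) (use int in \<open>auto simp: resolvent_def\<close>)
  qed
  ultimately show ?thesis by simp
qed

end

section \<open>The resolvent as a limit of successive approximations\<close>

text \<open>
  Successive approximations, started in \<open>0\<close>, to a solution of
  \<open>D * g x = f x + (\<Sum>z\<in>N x. w x z * g z)\<close>.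
\<close>

primrec cost_iter :: "(state \<Rightarrow> state \<Rightarrow> real) \<Rightarrow> (state \<Rightarrow> state set) \<Rightarrow> real \<Rightarrow>
    (state \<Rightarrow> real) \<Rightarrow> nat \<Rightarrow> state \<Rightarrow> real" where
  "cost_iter w N D f 0 = (\<lambda>x. 0)"
| "cost_iter w N D f (Suc k) = (\<lambda>x. (f x + (\<Sum>z\<in>N x. w x z * cost_iter w N D f k z)) / D)"

lemma cost_iter_nonneg:
  assumes "\<And>x z. 0 \<le> w x z" "0 < D" "\<And>x. 0 \<le> f x"
  shows "0 \<le> cost_iter w N D f k x"
  by (induction k arbitrary: x) (use assms in \<open>auto intro!: divide_nonneg_pos add_nonneg_nonneg sum_nonneg\<close>)

lemma cost_iter_Suc_ge:
  assumes "\<And>x z. 0 \<le> w x z" "0 < D" "\<And>x. 0 \<le> f x"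
  shows "cost_iter w N D f k x \<le> cost_iter w N D f (Suc k) x"
proof (induction k arbitrary: x)
  case 0
  show ?case using cost_iter_nonneg[OF assms, where N = N and k = "Suc 0" and x = x] by simp
next
  case (Suc k)
  show ?case
    unfolding cost_iter.simps(2)[of w N D f k] cost_iter.simps(2)[of w N D f "Suc k"]
    by (intro divide_right_mono add_left_mono sum_mono mult_left_mono Suc.IH[unfolded cost_iter.simps(2)] assms)
       (use assms in auto)
qed

text \<open>
  The iterates are linear in the cost function. Working in the extended nonnegative reals allows
  the superposition of infinitely many point costs without any summability condition.
\<close>

lemma cost_iter_superposition:
  assumes w: "\<And>x z. 0 \<le> w x z" and D: "0 < D" and f: "\<And>x. 0 \<le> f x"
  shows "ennreal (cost_iter w N D f k x)
    = (\<integral>\<^sup>+ y. ennreal (f y) * ennreal (cost_iter w N D (\<lambda>z. kdelta z y) k x) \<partial>count_space UNIV)"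
proof (induction k arbitrary: x)
  case 0
  show ?case by simp
next
  case (Suc k)
  let ?c = "cost_iter w N D"
  have kd: "0 \<le> kdelta z y" for z y by (simp add: kdelta_def)
  have eq: "ennreal (?c g (Suc k) x)
      = ennreal (1 / D) * (ennreal (g x) + (\<Sum>z\<in>N x. ennreal (w x z) * ennreal (?c g k z)))"
    if "\<And>x. 0 \<le> g x" for g
  proof -
    have nn: "0 \<le> ?c g k z" for z by (rule cost_iter_nonneg[OF w D that])
    have "0 \<le> g x + (\<Sum>z\<in>N x. w x z * ?c g k z)"
      by (intro add_nonneg_nonneg sum_nonneg mult_nonneg_nonneg w nn that)
    then have "ennreal ((1 / D) * (g x + (\<Sum>z\<in>N x. w x z * ?c g k z)))
        = ennreal (1 / D) * ennreal (g x + (\<Sum>z\<in>N x. w x z * ?c g k z))"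
      using D by (intro ennreal_mult) auto
    then have "ennreal (?c g (Suc k) x) = ennreal (1 / D) * ennreal (g x + (\<Sum>z\<in>N x. w x z * ?c g k z))"
      by simp
    also have "ennreal (g x + (\<Sum>z\<in>N x. w x z * ?c g k z))
        = ennreal (g x) + (\<Sum>z\<in>N x. ennreal (w x z) * ennreal (?c g k z))"
      using that by (simp add: ennreal_plus sum_nonneg w nn sum_ennreal[symmetric] ennreal_mult del: sum_ennreal)
    finally show ?thesis .
  qed
  have delta: "(\<integral>\<^sup>+ y. ennreal (f y) * ennreal (kdelta x y) \<partial>count_space UNIV) = ennreal (f x)"
  proof -
    have "(\<integral>\<^sup>+ y. ennreal (f y) * ennreal (kdelta x y) \<partial>count_space UNIV)
        = (\<integral>\<^sup>+ y. ennreal (f y) * indicator {x} y \<partial>count_space UNIV)"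
      by (rule nn_integral_cong) (auto simp: kdelta_def indicator_def)
    then show ?thesis by (simp only: nn_integral_indicator_singleton sets_count_space) simp
  qed
  have "ennreal (?c f (Suc k) x) = ennreal (1 / D) * ((\<integral>\<^sup>+ y. ennreal (f y) * ennreal (kdelta x y) \<partial>count_space UNIV)
     + (\<Sum>z\<in>N x. \<integral>\<^sup>+ y. ennreal (w x z) * (ennreal (f y) * ennreal (?c (\<lambda>z. kdelta z y) k z)) \<partial>count_space UNIV))"
    by (simp only: eq[OF f] Suc.IH delta) (simp add: nn_integral_cmult)
  also have "\<dots> = (\<integral>\<^sup>+ y. ennreal (1 / D) * (ennreal (f y) * ennreal (kdelta x y)
     + (\<Sum>z\<in>N x. ennreal (w x z) * (ennreal (f y) * ennreal (?c (\<lambda>z. kdelta z y) k z)))) \<partial>count_space UNIV)"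
    by (simp add: nn_integral_cmult nn_integral_add nn_integral_sum)
  also have "\<dots> = (\<integral>\<^sup>+ y. ennreal (f y) * ennreal (?c (\<lambda>z. kdelta z y) (Suc k) x) \<partial>count_space UNIV)"
    by (rule nn_integral_cong) (simp only: eq[OF kd] distrib_left sum_distrib_left ac_simps)
  finally show ?case .
qed

context bounded_generator
begin

text \<open>
  The uniformised weights: \<open>L\<close> times the transition probabilities of the jump chain.
\<close>

abbreviation w :: "state \<Rightarrow> state \<Rightarrow> real" where
  "w \<equiv> (\<lambda>x z. q x z + L * kdelta x z)"

lemma resolvent_fixed_point:
  assumes "0 < \<alpha>"
  shows "resolvent \<alpha> x y = (kdelta x y + (\<Sum>z\<in>N x. w x z * resolvent \<alpha> z y)) / (L + \<alpha>)"
proof -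
  have "(\<Sum>z\<in>N x. w x z * resolvent \<alpha> z y)
      = (\<Sum>z\<in>N x. q x z * resolvent \<alpha> z y) + L * (\<Sum>z\<in>N x. kdelta x z * resolvent \<alpha> z y)"
    by (simp add: distrib_right sum.distrib sum_distrib_left mult.assoc del: sum_kdelta)
  then have "kdelta x y + (\<Sum>z\<in>N x. w x z * resolvent \<alpha> z y) = (L + \<alpha>) * resolvent \<alpha> x y"
    using resolvent_equation[OF assms, of x y] by (simp add: sum_N_kdelta algebra_simps)
  then show ?thesis using assms L_pos by (simp add: field_simps)
qed

text \<open>
  For a point cost the resolvent is a bounded fixed point of the iteration, which contracts
  by the factor \<open>L / (L + \<alpha>)\<close>.
\<close>

lemma resolvent_approx:
  assumes "0 < \<alpha>"
  shows "0 \<le> resolvent \<alpha> x y - cost_iter w N (L + \<alpha>) (\<lambda>z. kdelta z y) k x \<and>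
    resolvent \<alpha> x y - cost_iter w N (L + \<alpha>) (\<lambda>z. kdelta z y) k x \<le> (L / (L + \<alpha>)) ^ k / \<alpha>"
proof (induction k arbitrary: x)
  case 0
  show ?case using resolvent_nonneg resolvent_le[OF assms] by simp
next
  case (Suc k)
  let ?d = "\<lambda>k x. resolvent \<alpha> x y - cost_iter w N (L + \<alpha>) (\<lambda>z. kdelta z y) k x"
  have w0: "0 \<le> w x z" for z by (simp add: unif_nonneg)
  have pos: "0 < L + \<alpha>" using assms L_pos by simp
  have d: "?d (Suc k) x = (\<Sum>z\<in>N x. w x z * ?d k z) / (L + \<alpha>)"
    by (subst resolvent_fixed_point[OF assms])
       (simp add: diff_divide_distrib[symmetric] sum_subtractf right_diff_distrib)
  have "(\<Sum>z\<in>N x. w x z * ?d k z) \<le> (\<Sum>z\<in>N x. w x z * ((L / (L + \<alpha>)) ^ k / \<alpha>))"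
    by (intro sum_mono mult_left_mono w0) (use Suc.IH in blast)
  also have "\<dots> = L * ((L / (L + \<alpha>)) ^ k / \<alpha>)"
    unfolding sum_distrib_right[symmetric] using unif_sum[of x] by simp
  finally have "?d (Suc k) x \<le> L * ((L / (L + \<alpha>)) ^ k / \<alpha>) / (L + \<alpha>)"
    unfolding d using pos by (intro divide_right_mono) auto
  moreover have "0 \<le> ?d (Suc k) x"
    unfolding d using pos w0 Suc.IH by (intro divide_nonneg_pos sum_nonneg mult_nonneg_nonneg) auto
  ultimately show ?case by (simp add: mult.commute)
qed

lemma SUP_cost_iter_kdelta:
  assumes "0 < \<alpha>"
  shows "(SUP k. ennreal (cost_iter w N (L + \<alpha>) (\<lambda>z. kdelta z y) k x)) = ennreal (resolvent \<alpha> x y)"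
proof (rule LIMSEQ_unique[OF LIMSEQ_SUP])
  let ?c = "cost_iter w N (L + \<alpha>) (\<lambda>z. kdelta z y)"
  have w0: "0 \<le> w x z" for x z by (simp add: unif_nonneg)
  have pos: "0 < L + \<alpha>" using assms L_pos by simp
  show "incseq (\<lambda>k. ennreal (?c k x))"
    by (intro incseq_SucI ennreal_leI cost_iter_Suc_ge w0 pos) (simp add: kdelta_def)
  have "(\<lambda>k. resolvent \<alpha> x y - ?c k x) \<longlonglongrightarrow> 0"
  proof (rule tendsto_sandwich[OF _ _ tendsto_const])
    have "(\<lambda>k. (L / (L + \<alpha>)) ^ k / \<alpha>) \<longlonglongrightarrow> 0 / \<alpha>"
      by (intro tendsto_divide tendsto_const LIMSEQ_realpow_zero) (use assms L_pos in auto)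
    then show "(\<lambda>k. (L / (L + \<alpha>)) ^ k / \<alpha>) \<longlonglongrightarrow> 0" by simp
  qed (use resolvent_approx[OF assms] in auto)
  then have "(\<lambda>k. resolvent \<alpha> x y - (resolvent \<alpha> x y - ?c k x)) \<longlonglongrightarrow> resolvent \<alpha> x y - 0"
    by (intro tendsto_diff tendsto_const)
  then have "(\<lambda>k. ?c k x) \<longlonglongrightarrow> resolvent \<alpha> x y" by simp
  then show "(\<lambda>k. ennreal (?c k x)) \<longlonglongrightarrow> ennreal (resolvent \<alpha> x y)"
    by (rule tendsto_ennrealI)
qed

text \<open>
  For an arbitrary nonnegative cost function, possibly with infinite value, the
  iterates increase to the total cost weighted by the resolvent.
\<close>

lemma SUP_cost_iter:
  assumes "0 < \<alpha>" "\<And>x. 0 \<le> f x"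
  shows "(SUP k. ennreal (cost_iter w N (L + \<alpha>) f k x))
    = (\<integral>\<^sup>+ y. ennreal (f y) * ennreal (resolvent \<alpha> x y) \<partial>count_space UNIV)"
proof -
  let ?c = "\<lambda>k y. cost_iter w N (L + \<alpha>) (\<lambda>z. kdelta z y) k x"
  have w0: "0 \<le> w x z" for x z by (simp add: unif_nonneg)
  have pos: "0 < L + \<alpha>" using assms L_pos by simp
  have "(SUP k. ennreal (cost_iter w N (L + \<alpha>) f k x))
      = (SUP k. \<integral>\<^sup>+ y. ennreal (f y) * ennreal (?c k y) \<partial>count_space UNIV)"
    by (simp only: cost_iter_superposition[OF w0 pos assms(2)])
  also have "\<dots> = (\<integral>\<^sup>+ y. (SUP k. ennreal (f y) * ennreal (?c k y)) \<partial>count_space UNIV)"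
  proof (rule nn_integral_monotone_convergence_SUP[symmetric])
    show "incseq (\<lambda>k y. ennreal (f y) * ennreal (?c k y))"
      by (intro incseq_SucI le_funI mult_left_mono ennreal_leI cost_iter_Suc_ge w0 pos)
         (auto simp: kdelta_def)
  qed simp
  also have "\<dots> = (\<integral>\<^sup>+ y. ennreal (f y) * ennreal (resolvent \<alpha> x y) \<partial>count_space UNIV)"
    by (simp only: SUP_mult_left_ennreal[symmetric] SUP_cost_iter_kdelta[OF assms(1)])
  finally show ?thesis .
qed

end

section \<open>Expected discounted costs along paths\<close>

lemma open_singleton_state: "open {x :: state}"
proof -
  have "open ({fst x} \<times> {snd x})" by (intro open_Times) (simp_all add: discrete_topology_class.open_discrete)
  then show ?thesis by simp
qed

lemma tendsto_state_iff: "(f \<longlongrightarrow> (x :: state)) F \<longleftrightarrow> (\<forall>\<^sub>F t in F. f t = x)"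
proof
  assume "(f \<longlongrightarrow> x) F"
  from topological_tendstoD[OF this open_singleton_state] show "\<forall>\<^sub>F t in F. f t = x" by simp
qed (rule tendsto_eventually)

text \<open>
  After each of its discontinuities, a right-continuous path stays constant on a nonempty open interval that
  contains no further discontinuity. These intervals are disjoint, so there are
  only countably many of them.
\<close>

lemma AE_left_limit:
  fixes f :: "real \<Rightarrow> state"
  assumes rc: "\<And>t. 0 \<le> t \<Longrightarrow> (f \<longlongrightarrow> f t) (at_right t)"
  shows "AE t in lborel. 0 \<le> t \<longrightarrow> Lim (at_left t) f = f t"
proof -
  define D where "D = {t. 0 < t \<and> \<not> (\<forall>\<^sub>F s in at_left t. f s = f t)}"
  have "\<exists>b>t. \<forall>s>t. s < b \<longrightarrow> f s = f t" if "0 \<le> t" for t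
    using rc[OF that] by (simp add: tendsto_state_iff eventually_at_right_field)
  then obtain b where b: "\<And>t. 0 \<le> t \<Longrightarrow> t < b t" "\<And>t s. 0 \<le> t \<Longrightarrow> t < s \<Longrightarrow> s < b t \<Longrightarrow> f s = f t"
    by metis
  have sep: "b s \<le> t" if "s \<in> D" "t \<in> D" "s < t" for s t
  proof (rule ccontr)
    assume "\<not> b s \<le> t"
    then have "f r = f t" if "s < r" "r < t" for r
      using b(2)[of s r] b(2)[of s t] \<open>s \<in> D\<close> \<open>s < t\<close> that by (auto simp: D_def)
    then have "\<forall>\<^sub>F r in at_left t. f r = f t"
      using \<open>s < t\<close> by (auto simp: eventually_at_left_field)
    with \<open>t \<in> D\<close> show False by (simp add: D_def)
  qed
  have "countable D"
  proof -
    have Dpos: "0 \<le> s" if "s \<in> D" for s using that by (simp add: D_def)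
    have disj: "{s<..<b s} \<inter> {t<..<b t} = {}" if "s \<in> D" "t \<in> D" "s \<noteq> t" for s t
      using sep[of s t] sep[of t s] that by (cases "s < t") auto
    have "countable ((\<lambda>s. {s<..<b s}) ` D)"
      by (rule countable_disjoint_open_subsets) (auto simp: pairwise_def disjnt_def dest: disj)
    moreover have "inj_on (\<lambda>s. {s<..<b s}) D"
    proof (rule inj_onI)
      fix s t assume st: "s \<in> D" "t \<in> D" "{s<..<b s} = {t<..<b t}"
      show "s = t"
      proof (rule ccontr)
        assume "s \<noteq> t"
        with disj[of s t] st have "{s<..<b s} = {}" by auto
        with b(1)[OF Dpos[OF st(1)]] show False by simp
      qed
    qed
    ultimately show ?thesis by (rule countable_image_inj_on)
  qed
  then have "insert 0 D \<in> null_sets lborel" by (intro countable_imp_null_set_lborel) simp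
  from AE_not_in[OF this] show ?thesis
  proof eventually_elim
    case (elim t)
    show ?case
    proof
      assume "0 \<le> t"
      with elim have "\<forall>\<^sub>F s in at_left t. f s = f t" by (auto simp: D_def)
      then have "(f \<longlongrightarrow> f t) (at_left t)" by (simp add: tendsto_state_iff)
      then show "Lim (at_left t) f = f t" by (intro tendsto_Lim) auto
    qed
  qed
qed

text \<open>
  The path at time \<open>t\<close> is eventually equal to its values on the grid points
  \<open>\<tau> n t > t\<close> with mesh \<open>1 / Suc n\<close>, which are piecewise constant in \<open>t\<close>.
\<close>

lemma joint_measurability:
  fixes Y :: "real \<Rightarrow> 'w \<Rightarrow> state"
  assumes meas: "\<And>t. 0 \<le> t \<Longrightarrow> Y t \<in> measurable M (count_space UNIV)"
    and rc: "\<And>\<omega> t. \<omega> \<in> space M \<Longrightarrow> 0 \<le> t \<Longrightarrow> ((\<lambda>s. Y s \<omega>) \<longlongrightarrow> Y t \<omega>) (at_right t)"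
  shows "{(\<omega>, t). \<omega> \<in> space M \<and> 0 \<le> t \<and> Y t \<omega> = y} \<in> sets (M \<Otimes>\<^sub>M lborel)"
proof -
  define \<tau> where "\<tau> = (\<lambda>(n::nat) (t::real). (real (nat \<lfloor>t * real (Suc n)\<rfloor>) + 1) / real (Suc n))"
  define A where "A = (\<lambda>n. {(\<omega>, t). \<omega> \<in> space M \<and> 0 \<le> t \<and> Y (\<tau> n t) \<omega> = y})"
  have \<tau>_bounds: "t < \<tau> n t" "\<tau> n t \<le> t + 1 / real (Suc n)" if "0 \<le> t" for n t
  proof -
    define v where "v = t * real (Suc n)"
    have "0 \<le> v" using that by (simp add: v_def)
    then have v: "real (nat \<lfloor>v\<rfloor>) \<le> v" "v < real (nat \<lfloor>v\<rfloor>) + 1" by linarith+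
    have eq: "\<tau> n t = (real (nat \<lfloor>v\<rfloor>) + 1) / real (Suc n)" "t = v / real (Suc n)"
      by (simp_all add: \<tau>_def v_def)
    show "t < \<tau> n t"
      unfolding eq(1) by (subst eq(2), rule divide_strict_right_mono) (use v in auto)
    have "\<tau> n t \<le> (v + 1) / real (Suc n)"
      unfolding eq(1) by (rule divide_right_mono) (use v in auto)
    then show "\<tau> n t \<le> t + 1 / real (Suc n)"
      by (subst eq(2)) (simp only: add_divide_distrib)
  qed
  have \<tau>_lim: "filterlim (\<lambda>n. \<tau> n t) (at_right t) sequentially" if "0 \<le> t" for t
  proof -
    have "(\<lambda>n. t + 1 / real (Suc n)) \<longlonglongrightarrow> t + 0"
      by (intro tendsto_add tendsto_const LIMSEQ_Suc[OF lim_1_over_n])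
    then have upper: "(\<lambda>n. t + 1 / real (Suc n)) \<longlonglongrightarrow> t" by simp
    have "(\<lambda>n. \<tau> n t) \<longlonglongrightarrow> t"
      by (rule tendsto_sandwich[OF _ _ tendsto_const upper])
         (use \<tau>_bounds[OF that] in \<open>auto intro!: always_eventually intro: less_imp_le\<close>)
    moreover have "\<tau> n t \<noteq> t" for n
      using \<tau>_bounds(1)[OF that, of n] by simp
    ultimately show ?thesis
      using \<tau>_bounds(1)[OF that] by (simp add: filterlim_at)
  qed
  have A: "A n \<in> sets (M \<Otimes>\<^sub>M lborel)" for n
  proof -
    have "A n = (\<Union>j. (Y ((real j + 1) / real (Suc n)) -` {y} \<inter> space M)
        \<times> {t. 0 \<le> t \<and> nat \<lfloor>t * real (Suc n)\<rfloor> = j})"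
      by (auto simp: A_def \<tau>_def)
    also have "\<dots> \<in> sets (M \<Otimes>\<^sub>M lborel)"
    proof (intro sets.countable_UN image_subsetI pair_measureI)
      fix j :: nat
      show "Y ((real j + 1) / real (Suc n)) -` {y} \<inter> space M \<in> sets M"
        by (intro measurable_sets[OF meas]) auto
      show "{t. 0 \<le> t \<and> nat \<lfloor>t * real (Suc n)\<rfloor> = j} \<in> sets lborel"
        by measurable
    qed
    finally show ?thesis .
  qed
  have "{(\<omega>, t). \<omega> \<in> space M \<and> 0 \<le> t \<and> Y t \<omega> = y} = (\<Union>n. \<Inter>k. A (n + k))"
  proof (intro set_eqI, clarify)
    fix \<omega> t
    have "Y t \<omega> = y \<longleftrightarrow> (\<exists>n. \<forall>k. Y (\<tau> (n + k) t) \<omega> = y)" if "\<omega> \<in> space M" "0 \<le> t"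
    proof -
      have "\<forall>\<^sub>F s in at_right t. Y s \<omega> = Y t \<omega>"
        using rc[OF that] by (simp add: tendsto_state_iff)
      from eventually_compose_filterlim[OF this \<tau>_lim[OF that(2)]]
      obtain n0 where n0: "\<And>n. n0 \<le> n \<Longrightarrow> Y (\<tau> n t) \<omega> = Y t \<omega>"
        by (auto simp: eventually_sequentially)
      show ?thesis
      proof
        assume "Y t \<omega> = y"
        then show "\<exists>n. \<forall>k. Y (\<tau> (n + k) t) \<omega> = y" using n0 by (intro exI[of _ n0]) auto
      next
        assume "\<exists>n. \<forall>k. Y (\<tau> (n + k) t) \<omega> = y"
        then obtain n where "Y (\<tau> (n + n0) t) \<omega> = y" by blast
        with n0[of "n + n0"] show "Y t \<omega> = y" by simp
      qed
    qed
    then show "((\<omega>, t) \<in> {(\<omega>, t). \<omega> \<in> space M \<and> 0 \<le> t \<and> Y t \<omega> = y})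
        = ((\<omega>, t) \<in> (\<Union>n. \<Inter>k. A (n + k)))"
      by (auto simp: A_def)
  qed
  also have "\<dots> \<in> sets (M \<Otimes>\<^sub>M lborel)"
    by (intro sets.countable_UN image_subsetI sets.countable_INT) (use A in auto)
  finally show ?thesis .
qed

lemma markov_chain_marginal:
  assumes prob: "prob_space M"
    and meas: "\<And>t. 0 \<le> t \<Longrightarrow> Y t \<in> measurable M (count_space UNIV)"
    and fdd: "\<And>(k::nat) (t :: nat \<Rightarrow> real) y. t 0 = 0 \<Longrightarrow> (\<forall>l<k. t l \<le> t (Suc l)) \<Longrightarrow>
       measure M {\<omega> \<in> space M. \<forall>l\<le>k. Y (t l) \<omega> = y l}
         = kdelta x (y 0) * (\<Prod>l<k. p (t (Suc l) - t l) (y l) (y (Suc l)))"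
    and t: "0 \<le> t"
  shows "emeasure M {\<omega> \<in> space M. Y t \<omega> = y} = ennreal (p t x y)"
proof -
  interpret prob_space M by (rule prob)
  have sets: "{\<omega> \<in> space M. Y s \<omega> = z} \<in> sets M" if "0 \<le> s" for s z
  proof -
    have "{\<omega> \<in> space M. Y s \<omega> = z} = Y s -` {z} \<inter> space M" by auto
    then show ?thesis using measurable_sets[OF meas[OF that], of "{z}"] by simp
  qed
  \<comment> \<open>The finite-dimensional distribution at the single time \<open>0\<close> fixes the initial state.\<close>
  have "prob {\<omega> \<in> space M. Y 0 \<omega> = x} = 1"
    using fdd[of "\<lambda>_. 0" 0 "\<lambda>_. x"] by (simp add: kdelta_def)
  then have "AE \<omega> in M. \<omega> \<in> {\<omega> \<in> space M. Y 0 \<omega> = x}"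
    by (subst (asm) prob_eq_1[OF sets]) auto
  then have start: "AE \<omega> in M. Y 0 \<omega> = x" by eventually_elim simp
  let ?t = "\<lambda>l::nat. if l = 0 then 0 else t" and ?y = "\<lambda>l::nat. if l = 0 then x else y"
  have "prob {\<omega> \<in> space M. \<forall>l\<le>Suc 0. Y (?t l) \<omega> = ?y l} = p t x y"
    using fdd[of ?t "Suc 0" ?y] t by (simp add: kdelta_def)
  moreover have "{\<omega> \<in> space M. \<forall>l\<le>Suc 0. Y (?t l) \<omega> = ?y l}
      = {\<omega> \<in> space M. Y 0 \<omega> = x} \<inter> {\<omega> \<in> space M. Y t \<omega> = y}"
    by (auto simp: le_Suc_eq)
  ultimately have "prob ({\<omega> \<in> space M. Y 0 \<omega> = x} \<inter> {\<omega> \<in> space M. Y t \<omega> = y}) = p t x y" by simp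
  moreover have "prob ({\<omega> \<in> space M. Y 0 \<omega> = x} \<inter> {\<omega> \<in> space M. Y t \<omega> = y})
      = prob {\<omega> \<in> space M. Y t \<omega> = y}"
    by (rule finite_measure_eq_AE) (use start sets t in auto)
  ultimately show ?thesis by (simp add: emeasure_eq_measure)
qed

text \<open>
  The cost depends on the current state and on the left limit, which agree for almost every time. Splitting
  the cost according to the visited state and using Tonelli's theorem turns the expectation into a
  sum over states.
\<close>

lemma (in bounded_generator) expected_cost_eq_resolvent:
  fixes Y :: "real \<Rightarrow> 'w \<Rightarrow> state" and c :: "state \<Rightarrow> state \<Rightarrow> real"
  assumes prob: "prob_space M"
    and meas: "\<And>t. 0 \<le> t \<Longrightarrow> Y t \<in> measurable M (count_space UNIV)"
    and rc: "\<And>\<omega> t. \<omega> \<in> space M \<Longrightarrow> 0 \<le> t \<Longrightarrow> ((\<lambda>s. Y s \<omega>) \<longlongrightarrow> Y t \<omega>) (at_right t)"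
    and marginal: "\<And>t y. 0 \<le> t \<Longrightarrow> emeasure M {\<omega> \<in> space M. Y t \<omega> = y} = ennreal (p t x y)"
    and c: "\<And>y. 0 \<le> c y y" and \<alpha>: "0 < \<alpha>"
  shows "(\<integral>\<^sup>+ \<omega>. (\<integral>\<^sup>+ t \<in> {0..}. ennreal (exp (- \<alpha> * t) *
            c (Y t \<omega>) (Lim (at_left t) (\<lambda>s. Y s \<omega>))) \<partial>lborel) \<partial>M)
    = (\<integral>\<^sup>+ y. ennreal (c y y) * ennreal (resolvent \<alpha> x y) \<partial>count_space UNIV)"
proof -
  interpret prob_space M by (rule prob)
  interpret pair_sigma_finite M lborel ..
  define B where "B = (\<lambda>y. {(\<omega>, t). \<omega> \<in> space M \<and> 0 \<le> t \<and> Y t \<omega> = y})"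
  have B[measurable]: "B y \<in> sets (M \<Otimes>\<^sub>M lborel)" for y
    unfolding B_def by (rule joint_measurability[OF meas rc])
  \<comment> \<open>The discount factor, restricted to the times at which the path is in state \<open>y\<close>.\<close>
  define g where "g = (\<lambda>y \<omega> t. ennreal (exp (- \<alpha> * t)) * indicator (B y) (\<omega>, t) :: ennreal)"
  have g[measurable]: "(\<lambda>(\<omega>, t). g y \<omega> t) \<in> borel_measurable (M \<Otimes>\<^sub>M lborel)" for y
    unfolding g_def by measurable
  have path: "(\<integral>\<^sup>+ t \<in> {0..}. ennreal (exp (- \<alpha> * t) * c (Y t \<omega>) (Lim (at_left t) (\<lambda>s. Y s \<omega>))) \<partial>lborel)
      = (\<integral>\<^sup>+ y. \<integral>\<^sup>+ t. ennreal (c y y) * g y \<omega> t \<partial>lborel \<partial>count_space UNIV)"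
    if \<omega>: "\<omega> \<in> space M" for \<omega>
  proof -
    have "AE t in lborel. 0 \<le> t \<longrightarrow> Lim (at_left t) (\<lambda>s. Y s \<omega>) = Y t \<omega>"
      by (rule AE_left_limit) (rule rc[OF \<omega>])
    then have "(\<integral>\<^sup>+ t \<in> {0..}. ennreal (exp (- \<alpha> * t) * c (Y t \<omega>) (Lim (at_left t) (\<lambda>s. Y s \<omega>))) \<partial>lborel)
      = (\<integral>\<^sup>+ t. (\<integral>\<^sup>+ y. ennreal (c y y) * g y \<omega> t \<partial>count_space UNIV) \<partial>lborel)"
    proof (intro nn_integral_cong_AE, eventually_elim)
      case (elim t)
      show ?case
      proof (cases "0 \<le> t")
        case True
        have "(\<integral>\<^sup>+ y. ennreal (c y y) * g y \<omega> t \<partial>count_space UNIV)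
          = (\<integral>\<^sup>+ y. (ennreal (c y y) * ennreal (exp (- \<alpha> * t))) * indicator {Y t \<omega>} y \<partial>count_space UNIV)"
          by (rule nn_integral_cong) (use True \<omega> in \<open>auto simp: g_def B_def indicator_def\<close>)
        also have "\<dots> = ennreal (c (Y t \<omega>) (Y t \<omega>)) * ennreal (exp (- \<alpha> * t))"
          by (subst nn_integral_indicator_singleton) auto
        finally show ?thesis
          using True elim by (simp add: ennreal_mult c mult.commute)
      next
        case False
        then show ?thesis by (simp add: g_def B_def)
      qed
    qed
    also have "\<dots> = (\<integral>\<^sup>+ y. \<integral>\<^sup>+ t. ennreal (c y y) * g y \<omega> t \<partial>lborel \<partial>count_space UNIV)"
      by (rule nn_integral_count_space_nn_integral) (use \<omega> in measurable)
    finally show ?thesis .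
  qed
  have inner: "(\<integral>\<^sup>+ \<omega>. \<integral>\<^sup>+ t. g y \<omega> t \<partial>lborel \<partial>M) = ennreal (resolvent \<alpha> x y)" for y
  proof -
    have "(\<integral>\<^sup>+ \<omega>. \<integral>\<^sup>+ t. g y \<omega> t \<partial>lborel \<partial>M) = (\<integral>\<^sup>+ t. \<integral>\<^sup>+ \<omega>. g y \<omega> t \<partial>M \<partial>lborel)"
      by (rule Fubini'[symmetric]) (rule g)
    also have "\<dots> = (\<integral>\<^sup>+ t. ennreal (indicator {0<..} t *\<^sub>R (exp (- \<alpha> * t) * p t x y)) \<partial>lborel)"
    proof (rule nn_integral_cong_AE)
      show "AE t in lborel. (\<integral>\<^sup>+ \<omega>. g y \<omega> t \<partial>M) = ennreal (indicator {0<..} t *\<^sub>R (exp (- \<alpha> * t) * p t x y))"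
        using AE_lborel_singleton[of 0]
      proof eventually_elim
        case (elim t)
        show ?case
        proof (cases "0 < t")
          case True
          have "(\<integral>\<^sup>+ \<omega>. g y \<omega> t \<partial>M)
              = (\<integral>\<^sup>+ \<omega>. ennreal (exp (- \<alpha> * t)) * indicator {\<omega> \<in> space M. Y t \<omega> = y} \<omega> \<partial>M)"
            by (rule nn_integral_cong) (use True in \<open>auto simp: g_def B_def indicator_def\<close>)
          also have "\<dots> = ennreal (exp (- \<alpha> * t)) * ennreal (p t x y)"
          proof -
            have "{\<omega> \<in> space M. Y t \<omega> = y} = Y t -` {y} \<inter> space M" by auto
            then have "{\<omega> \<in> space M. Y t \<omega> = y} \<in> sets M"
              using measurable_sets[OF meas[of t], of "{y}"] True by simp
            then show ?thesis using marginal[of t y] True by (simp add: nn_integral_cmult_indicator)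
          qed
          finally show ?thesis using True by (simp add: ennreal_mult p_nonneg)
        next
          case False
          with elim have "t < 0" by simp
          then show ?thesis by (simp add: g_def B_def)
        qed
      qed
    qed
    also have "\<dots> = ennreal (resolvent \<alpha> x y)"
      unfolding resolvent_def set_lebesgue_integral_def
      by (rule nn_integral_eq_integral)
         (use set_integrable_discounted[OF \<alpha>] in \<open>auto simp: set_integrable_def indicator_def p_nonneg\<close>)
    finally show ?thesis .
  qed
  have "(\<integral>\<^sup>+ \<omega>. (\<integral>\<^sup>+ t \<in> {0..}. ennreal (exp (- \<alpha> * t) *
            c (Y t \<omega>) (Lim (at_left t) (\<lambda>s. Y s \<omega>))) \<partial>lborel) \<partial>M)
      = (\<integral>\<^sup>+ \<omega>. \<integral>\<^sup>+ y. \<integral>\<^sup>+ t. ennreal (c y y) * g y \<omega> t \<partial>lborel \<partial>count_space UNIV \<partial>M)"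
    by (rule nn_integral_cong) (rule path)
  also have "\<dots> = (\<integral>\<^sup>+ y. \<integral>\<^sup>+ \<omega>. \<integral>\<^sup>+ t. ennreal (c y y) * g y \<omega> t \<partial>lborel \<partial>M \<partial>count_space UNIV)"
    by (rule nn_integral_count_space_nn_integral) measurable
  also have "\<dots> = (\<integral>\<^sup>+ y. ennreal (c y y) * ennreal (resolvent \<alpha> x y) \<partial>count_space UNIV)"
  proof (rule nn_integral_cong)
    fix y
    have "(\<integral>\<^sup>+ \<omega>. \<integral>\<^sup>+ t. ennreal (c y y) * g y \<omega> t \<partial>lborel \<partial>M)
        = (\<integral>\<^sup>+ \<omega>. ennreal (c y y) * (\<integral>\<^sup>+ t. g y \<omega> t \<partial>lborel) \<partial>M)"
      by (intro nn_integral_cong nn_integral_cmult) measurable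
    also have "\<dots> = ennreal (c y y) * (\<integral>\<^sup>+ \<omega>. \<integral>\<^sup>+ t. g y \<omega> t \<partial>lborel \<partial>M)"
      by (rule nn_integral_cmult) measurable
    finally show "(\<integral>\<^sup>+ \<omega>. \<integral>\<^sup>+ t. ennreal (c y y) * g y \<omega> t \<partial>lborel \<partial>M)
        = ennreal (c y y) * ennreal (resolvent \<alpha> x y)"
      by (simp only: inner)
  qed
  finally show ?thesis .
qed

section \<open>Value iteration and optimality\<close>

lemma policies_actions: "\<beta> \<in> policies m \<Longrightarrow> \<beta> x \<in> actions m"
  unfolding policies_def by blast

text \<open>
  Value iteration for a fixed stationary policy \<open>\<beta>\<close>: the \<open>k\<close>-th iterate, started in \<open>0\<close>, of
  \<open>v x \<mapsto> T_action m \<alpha> v x (\<beta> x)\<close>.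
\<close>

definition policy_iter :: "inventory_model \<Rightarrow> real \<Rightarrow> policy \<Rightarrow> nat \<Rightarrow> state \<Rightarrow> real" where
  "policy_iter m \<alpha> \<beta> =
     cost_iter (\<lambda>x z. rate m (\<beta> x) x z + total_rate m * kdelta x z) nbhd (total_rate m + \<alpha>)
       (\<lambda>x. cost m x (\<beta> x))"

lemma policy_iter_0: "policy_iter m \<alpha> \<beta> 0 x = 0"
  by (simp add: policy_iter_def)

lemma policy_iter_Suc:
  assumes "valid_model m" "\<alpha> > 0"
  shows "policy_iter m \<alpha> \<beta> (Suc k) x = T_action m \<alpha> (policy_iter m \<alpha> \<beta> k) x (\<beta> x)"
  unfolding T_action_eq[OF assms] by (simp add: policy_iter_def)

text \<open>
  The probabilistic criterion is reduced to a monotone iteration with finite sums.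
\<close>

lemma discounted_cost_eq_SUP:
  fixes P :: "policy \<Rightarrow> state \<Rightarrow> 'w measure"
  assumes valid: "valid_model m" and \<alpha>: "\<alpha> > 0"
    and chains: "controlled_chains m P Y" and \<beta>: "\<beta> \<in> policies m"
  shows "discounted_cost m \<alpha> P Y \<beta> x = (SUP k. ennreal (policy_iter m \<alpha> \<beta> k x))"
proof -
  have act: "\<beta> y \<in> actions m" for y by (rule policies_actions[OF \<beta>])
  have mc: "markov_chain (\<lambda>y. rate m (\<beta> y) y) x (P \<beta> x) (Y \<beta> x)"
    using chains \<beta> unfolding controlled_chains_def by blast
  then obtain p where p: "transition_function p"
      "\<And>y z. ((\<lambda>t. p t y z) has_real_derivative rate m (\<beta> y) y z) (at 0 within {0..})"
      "\<And>k (t :: nat \<Rightarrow> real) y. t 0 = 0 \<Longrightarrow> (\<forall>l<k. t l \<le> t (Suc l)) \<Longrightarrow>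
         measure (P \<beta> x) {\<omega> \<in> space (P \<beta> x). \<forall>l\<le>k. Y \<beta> x (t l) \<omega> = y l}
           = kdelta x (y 0) * (\<Prod>l<k. p (t (Suc l) - t l) (y l) (y (Suc l)))"
    unfolding markov_chain_def by blast
  have prob: "prob_space (P \<beta> x)"
    and meas: "\<And>t. 0 \<le> t \<Longrightarrow> Y \<beta> x t \<in> measurable (P \<beta> x) (count_space UNIV)"
    and rc: "\<And>\<omega> t. \<omega> \<in> space (P \<beta> x) \<Longrightarrow> 0 \<le> t \<Longrightarrow> ((\<lambda>s. Y \<beta> x s \<omega>) \<longlongrightarrow> Y \<beta> x t \<omega>) (at_right t)"
    using mc unfolding markov_chain_def by blast+
  interpret bounded_generator p "\<lambda>y. rate m (\<beta> y) y" nbhd "total_rate m"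
    by unfold_locales
       (use p(1,2) sum_rate unif_rate_nonneg[OF valid act] total_rate_pos[OF valid] in auto)
  have "discounted_cost m \<alpha> P Y \<beta> x
      = (\<integral>\<^sup>+ y. ennreal (cost m y (\<beta> y)) * ennreal (resolvent \<alpha> x y) \<partial>count_space UNIV)"
    unfolding discounted_cost_def
    by (rule expected_cost_eq_resolvent[where c = "\<lambda>y z. cost m y (\<beta> z)", OF prob meas rc _ _ \<alpha>])
       (auto intro: markov_chain_marginal[where M = "P \<beta> x" and Y = "Y \<beta> x" and p = p, OF prob meas p(3)] cost_nonneg[OF valid act])
  also have "\<dots> = (SUP k. ennreal (policy_iter m \<alpha> \<beta> k x))"
    unfolding policy_iter_def
    by (rule SUP_cost_iter[OF \<alpha>, symmetric]) (rule cost_nonneg[OF valid act])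
  finally show ?thesis .
qed

lemma weighted_space_iff:
  assumes W: "\<And>x. 1 \<le> W x"
  shows "u \<in> weighted_space W \<longleftrightarrow> (\<exists>B\<ge>0. \<forall>x. \<bar>u x\<bar> \<le> B * W x)"
proof
  have Wpos: "0 < W x" for x using W[of x] by linarith
  assume "u \<in> weighted_space W"
  then have fin: "weighted_norm W u < \<infinity>" by (simp add: weighted_space_def)
  have le: "ereal (\<bar>u x\<bar> / W x) \<le> weighted_norm W u" for x
    unfolding weighted_norm_def by (rule SUP_upper) simp
  have "0 \<le> weighted_norm W u"
    using order_trans[OF _ le[of undefined], of 0] Wpos[of undefined] by simp
  with fin obtain B where B: "weighted_norm W u = ereal B" "0 \<le> B"
    by (cases "weighted_norm W u") auto
  have "\<bar>u x\<bar> \<le> B * W x" for x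
    using le[of x] Wpos[of x] by (simp add: B pos_divide_le_eq)
  with B show "\<exists>B\<ge>0. \<forall>x. \<bar>u x\<bar> \<le> B * W x" by blast
next
  have Wpos: "0 < W x" for x using W[of x] by linarith
  assume "\<exists>B\<ge>0. \<forall>x. \<bar>u x\<bar> \<le> B * W x"
  then obtain B where "\<And>x. \<bar>u x\<bar> \<le> B * W x" by blast
  then have "weighted_norm W u \<le> ereal B"
    unfolding weighted_norm_def using Wpos by (intro SUP_least) (simp add: pos_divide_le_eq)
  then show "u \<in> weighted_space W"
    unfolding weighted_space_def using order_le_less_trans by fastforce
qed

lemma T_action_abs:
  assumes "valid_model m" "\<alpha> > 0" "a \<in> actions m"
  shows "\<bar>T_action m \<alpha> u x a\<bar> \<le> T_action m \<alpha> (\<lambda>y. \<bar>u y\<bar>) x a"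
proof -
  let ?w = "\<lambda>y. rate m a x y + total_rate m * kdelta x y"
  have "\<bar>cost m x a + (\<Sum>y\<in>nbhd x. ?w y * u y)\<bar> \<le> cost m x a + (\<Sum>y\<in>nbhd x. \<bar>?w y * u y\<bar>)"
    using sum_abs[of "\<lambda>y. ?w y * u y" "nbhd x"] cost_nonneg[OF assms(1,3), of x] by linarith
  also have "(\<Sum>y\<in>nbhd x. \<bar>?w y * u y\<bar>) = (\<Sum>y\<in>nbhd x. ?w y * \<bar>u y\<bar>)"
    using unif_rate_nonneg[OF assms(1,3)] by (simp add: abs_mult)
  finally show ?thesis
    using total_rate_pos[OF assms(1)] assms(2)
    unfolding T_action_eq[OF assms(1,2)] by (simp add: abs_divide divide_right_mono)
qed

text \<open>
  The drift inequality bounds the effect of the operator on affine functions of the weight; the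
  constant \<open>B\<close> contributes nothing to the drift because rates are conservative.
\<close>

lemma T_action_weight_le:
  assumes valid: "valid_model m" and \<alpha>: "\<alpha> > 0" and "0 \<le> A" "0 \<le> b"
    and drift: "(\<Sum>\<^sub>\<infinity>y. rate m a x y * W y) \<le> - c * W x + b * kdelta x (0, 0)"
    and bound: "cost m x a \<le> M * W x"
  shows "T_action m \<alpha> (\<lambda>y. A * W y + B) x a
    \<le> ((M + total_rate m * A - A * c) * W x + A * b + total_rate m * B) / (total_rate m + \<alpha>)"
proof -
  have "(\<Sum>y\<in>nbhd x. rate m a x y * (A * W y + B))
      = A * (\<Sum>y\<in>nbhd x. rate m a x y * W y) + (\<Sum>y\<in>nbhd x. rate m a x y) * B"
    by (simp add: sum_distrib_left sum_distrib_right sum.distrib algebra_simps)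
  then have "DCOE_action m (\<lambda>y. A * W y + B) x a
      = cost m x a + A * (\<Sum>\<^sub>\<infinity>y. rate m a x y * W y)"
    unfolding DCOE_action_def infsum_rate by (simp add: sum_rate)
  also have "\<dots> \<le> M * W x + A * (- c * W x + b)"
  proof (intro add_mono bound mult_left_mono)
    have "b * kdelta x (0, 0) \<le> b" using \<open>0 \<le> b\<close> by (simp add: kdelta_def)
    with drift show "(\<Sum>\<^sub>\<infinity>y. rate m a x y * W y) \<le> - c * W x + b" by linarith
  qed fact
  finally have "DCOE_action m (\<lambda>y. A * W y + B) x a + total_rate m * (A * W x + B)
      \<le> (M + total_rate m * A - A * c) * W x + A * b + total_rate m * B"
    by (simp add: algebra_simps)
  then show ?thesis
    unfolding T_action_DCOE_action[OF valid \<alpha>]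
    using total_rate_pos[OF valid] \<alpha> by (intro divide_right_mono) auto
qed

lemma T_op_weighted_space:
  assumes valid: "valid_model m" and \<alpha>: "\<alpha> > 0" and I: "assumption_I m W"
    and u: "u \<in> weighted_space W"
  shows "T_op m \<alpha> u \<in> weighted_space W"
proof -
  obtain c b M where W: "\<And>x. 1 \<le> W x" and pos: "c > 0" "b \<ge> 0" "M > 0"
    and I': "\<And>x a. a \<in> actions m \<Longrightarrow> (\<Sum>\<^sub>\<infinity>y. rate m a x y * W y) \<le> - c * W x + b * kdelta x (0, 0)"
      "\<And>x a. a \<in> actions m \<Longrightarrow> cost m x a \<le> M * W x"
    using I unfolding assumption_I_def by blast
  obtain A where A: "0 \<le> A" "\<And>x. \<bar>u x\<bar> \<le> A * W x"
    using u weighted_space_iff[of W, OF W] by blast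
  let ?L = "total_rate m"
  have L: "0 < ?L" by (rule total_rate_pos[OF valid])
  define K where "K = (M + ?L * A + A * b) / (?L + \<alpha>)"
  have K: "0 \<le> K" using A pos L \<alpha> by (auto simp: K_def intro!: divide_nonneg_pos add_nonneg_nonneg)
  have "\<bar>T_op m \<alpha> u x\<bar> \<le> K * W x" for x
  proof -
    obtain a where a: "a \<in> actions m" "T_op m \<alpha> u x = T_action m \<alpha> u x a"
      using T_op_attained[OF valid \<alpha>] .
    have "\<bar>T_op m \<alpha> u x\<bar> \<le> T_action m \<alpha> (\<lambda>y. \<bar>u y\<bar>) x a"
      unfolding a(2) by (rule T_action_abs[OF valid \<alpha> a(1)])
    also have "\<dots> \<le> T_action m \<alpha> (\<lambda>y. A * W y + 0) x a"
      by (rule T_action_mono[OF valid \<alpha> a(1)]) (use A in simp)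
    also have "\<dots> \<le> ((M + ?L * A - A * c) * W x + A * b + ?L * 0) / (?L + \<alpha>)"
      by (rule T_action_weight_le[OF valid \<alpha> A(1) pos(2) I'(1)[OF a(1)] I'(2)[OF a(1)]])
    also have "\<dots> \<le> ((M + ?L * A + A * b) * W x) / (?L + \<alpha>)"
    proof (rule divide_right_mono)
      have "A * b \<le> A * b * W x" using mult_left_mono[OF W[of x], of "A * b"] A pos by simp
      moreover have "0 \<le> A * c * W x" using A(1) pos(1) W[of x] by simp
      ultimately show "(M + ?L * A - A * c) * W x + A * b + ?L * 0 \<le> (M + ?L * A + A * b) * W x"
        by (simp add: algebra_simps)
    qed (use L \<alpha> in simp)
    finally show ?thesis by (simp add: K_def)
  qed
  with K show ?thesis using weighted_space_iff[of W, OF W] by blast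
qed

text \<open>
  The function \<open>(M / c) W + M b / (c \<alpha>)\<close> is a supersolution. The first coefficient makes the negative
  drift absorb the cost, and the constant absorbs the drift term \<open>b\<close>, which the
  discounting pays for.
\<close>

lemma supersolution:
  assumes valid: "valid_model m" and \<alpha>: "\<alpha> > 0" and I: "assumption_I m W"
  obtains s where "s \<in> weighted_space W" "\<And>x. 0 \<le> s x" "\<And>x. T_op m \<alpha> s x \<le> s x"
proof -
  obtain c b M where W: "\<And>x. 1 \<le> W x" and pos: "c > 0" "b \<ge> 0" "M > 0"
    and I': "\<And>x a. a \<in> actions m \<Longrightarrow> (\<Sum>\<^sub>\<infinity>y. rate m a x y * W y) \<le> - c * W x + b * kdelta x (0, 0)"
      "\<And>x a. a \<in> actions m \<Longrightarrow> cost m x a \<le> M * W x"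
    using I unfolding assumption_I_def by blast
  let ?L = "total_rate m"
  have L: "0 < ?L" by (rule total_rate_pos[OF valid])
  define A where "A = M / c"
  define B where "B = A * b / \<alpha>"
  define s where "s = (\<lambda>x. A * W x + B)"
  have A: "0 \<le> A" "A * c = M" using pos by (simp_all add: A_def)
  have B: "0 \<le> B" "A * b = \<alpha> * B" using A(1) pos \<alpha> by (simp_all add: B_def)
  have W0: "0 \<le> W x" for x using W[of x] by linarith
  have s0: "0 \<le> s x" for x using A B W0 by (simp add: s_def)
  have "s x \<le> (A + B) * W x" for x
    using mult_left_mono[OF W[of x] B(1)] by (simp add: s_def distrib_right)
  then have "\<exists>C\<ge>0. \<forall>x. \<bar>s x\<bar> \<le> C * W x"
    using s0 A B by (intro exI[of _ "A + B"]) simp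
  then have sW: "s \<in> weighted_space W" using weighted_space_iff[of W, OF W] by blast
  have "T_op m \<alpha> s x \<le> s x" for x
  proof -
    have a: "min_prod m \<in> actions m" using valid by (simp add: valid_model_def actions_def)
    have "T_op m \<alpha> s x \<le> T_action m \<alpha> (\<lambda>x. A * W x + B) x (min_prod m)"
      using T_op_le[OF valid \<alpha> a] by (simp add: s_def)
    also have "\<dots> \<le> ((M + ?L * A - A * c) * W x + A * b + ?L * B) / (?L + \<alpha>)"
      by (rule T_action_weight_le[OF valid \<alpha> A(1) pos(2) I'(1)[OF a] I'(2)[OF a]])
    also have "\<dots> = (?L * A * W x + (?L + \<alpha>) * B) / (?L + \<alpha>)"
      by (simp add: A(2) B(2) algebra_simps)
    also have "\<dots> \<le> ((?L + \<alpha>) * (A * W x + B)) / (?L + \<alpha>)"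
    proof (rule divide_right_mono)
      have "0 \<le> \<alpha> * (A * W x)" using \<alpha> A W0 by simp
      then show "?L * A * W x + (?L + \<alpha>) * B \<le> (?L + \<alpha>) * (A * W x + B)"
        by (simp add: algebra_simps)
    qed (use L \<alpha> in simp)
    also have "\<dots> = s x" using L \<alpha> by (simp add: s_def)
    finally show ?thesis .
  qed
  with sW s0 show thesis by (rule that)
qed

lemma value_iter_0 [simp]: "value_iter m \<alpha> 0 x = 0"
  by (simp add: value_iter_def)

lemma value_iter_Suc: "value_iter m \<alpha> (Suc k) = T_op m \<alpha> (value_iter m \<alpha> k)"
  by (simp add: value_iter_def)

lemma T_op_zero_nonneg:
  assumes "valid_model m" "\<alpha> > 0"
  shows "0 \<le> T_op m \<alpha> (\<lambda>_. 0) x"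
proof -
  obtain a where a: "a \<in> actions m" "T_op m \<alpha> (\<lambda>_. 0) x = T_action m \<alpha> (\<lambda>_. 0) x a"
    using T_op_attained[OF assms] .
  then show ?thesis
    using T_action_eq[OF assms] cost_nonneg[OF assms(1) a(1), of x] total_rate_pos[OF assms(1)] assms(2)
    by simp
qed

lemma value_iter_le_Suc:
  assumes "valid_model m" "\<alpha> > 0"
  shows "value_iter m \<alpha> k x \<le> value_iter m \<alpha> (Suc k) x"
proof (induction k arbitrary: x)
  case 0
  show ?case using T_op_zero_nonneg[OF assms] by (simp add: value_iter_def)
next
  case (Suc k)
  show ?case
    unfolding value_iter_Suc[of m \<alpha> "Suc k"] value_iter_Suc[of m \<alpha> k]
    by (rule T_op_mono[OF assms]) (use Suc.IH in \<open>simp only: value_iter_Suc\<close>)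
qed

lemma tendsto_T_action:
  assumes "valid_model m" "\<alpha> > 0" "\<And>y. (\<lambda>k. v k y) \<longlonglongrightarrow> u y"
  shows "(\<lambda>k. T_action m \<alpha> (v k) x a) \<longlonglongrightarrow> T_action m \<alpha> u x a"
  unfolding T_action_eq[OF assms(1,2)]
  by (intro tendsto_intros assms) (use total_rate_pos[OF assms(1)] assms(2) in auto)

lemma tendsto_T_op:
  assumes "valid_model m" "\<alpha> > 0" "\<And>y. (\<lambda>k. v k y) \<longlonglongrightarrow> u y"
  shows "(\<lambda>k. T_op m \<alpha> (v k) x) \<longlonglongrightarrow> T_op m \<alpha> u x"
  unfolding T_op_eq[OF assms(1,2)] by (intro tendsto_min tendsto_T_action assms)

text \<open>
  Convergence of \<^const>\<open>T_action\<close> is uniform over the actions, since it is affine in the action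
  and actions are bounded.
\<close>

lemma tendsto_T_action_diff:
  assumes "valid_model m" "\<alpha> > 0" "\<And>y. (\<lambda>k. v k y) \<longlonglongrightarrow> u y" "\<And>k. a k \<in> actions m"
  shows "(\<lambda>k. T_action m \<alpha> (v k) x (a k) - T_action m \<alpha> u x (a k)) \<longlonglongrightarrow> 0"
proof -
  note aff = T_action_affine[OF assms(1,2)]
  have sl: "(\<lambda>k. T_slope m \<alpha> (v k) x - T_slope m \<alpha> u x) \<longlonglongrightarrow> 0"
  proof -
    have "(\<lambda>k. T_slope m \<alpha> (v k) x) \<longlonglongrightarrow> T_slope m \<alpha> u x"
      unfolding T_slope_def
      by (intro tendsto_intros assms) (use total_rate_pos[OF assms(1)] assms(2) in auto)
    then show ?thesis by (simp add: LIM_zero_iff)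
  qed
  have c0: "(\<lambda>k. T_action m \<alpha> (v k) x 0 - T_action m \<alpha> u x 0) \<longlonglongrightarrow> 0"
    using tendsto_T_action[OF assms(1-3)] by (simp add: LIM_zero_iff)
  have bnd: "(\<lambda>k. max_prod m * norm (T_slope m \<alpha> (v k) x - T_slope m \<alpha> u x)) \<longlonglongrightarrow> 0"
    using tendsto_mult_right[OF tendsto_norm[OF sl], of "max_prod m"] by (simp add: mult.commute)
  have "(\<lambda>k. a k * (T_slope m \<alpha> (v k) x - T_slope m \<alpha> u x)) \<longlonglongrightarrow> 0"
  proof (rule Lim_null_comparison[OF always_eventually bnd], intro allI)
    fix k
    have "min_prod m \<le> a k" "a k \<le> max_prod m" "0 < min_prod m"
      using assms(1,4) by (auto simp: actions_def valid_model_def)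
    then show "norm (a k * (T_slope m \<alpha> (v k) x - T_slope m \<alpha> u x))
        \<le> max_prod m * norm (T_slope m \<alpha> (v k) x - T_slope m \<alpha> u x)"
      unfolding norm_mult by (intro mult_right_mono) auto
  qed
  from tendsto_add[OF c0 this]
  show ?thesis
    unfolding aff[of "v _" x "a _"] aff[of u x "a _"] by (simp add: algebra_simps)
qed

lemma DCOE_action_eq_T_action:
  assumes "valid_model m" "\<alpha> > 0"
  shows "DCOE_action m u x a = (total_rate m + \<alpha>) * T_action m \<alpha> u x a - total_rate m * u x"
  using T_action_DCOE_action[OF assms, of u x a] total_rate_pos[OF assms(1)] assms(2)
  by (simp add: field_simps)

lemma DCOE_action_less_iff:
  assumes "valid_model m" "\<alpha> > 0"
  shows "DCOE_action m u x a < DCOE_action m u x b \<longleftrightarrow> T_action m \<alpha> u x a < T_action m \<alpha> u x b"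
  unfolding DCOE_action_eq_T_action[OF assms]
  using total_rate_pos[OF assms(1)] assms(2) by simp

lemma DCOE_if_fixed_point:
  assumes valid: "valid_model m" and \<alpha>: "\<alpha> > 0" and fp: "u = T_op m \<alpha> u"
  shows "DCOE m \<alpha> u"
  unfolding DCOE_def
proof
  fix x
  obtain a where a: "a \<in> actions m" "T_op m \<alpha> u x = T_action m \<alpha> u x a"
    using T_op_attained[OF valid \<alpha>] .
  have eq: "DCOE_action m u x a = \<alpha> * u x"
    using a(2) fun_cong[OF fp, of x] by (simp add: DCOE_action_eq_T_action[OF valid \<alpha>] algebra_simps)
  have "(INF a\<in>actions m. DCOE_action m u x a) = DCOE_action m u x a"
  proof (rule cInf_eq_minimum)
    fix v assume "v \<in> DCOE_action m u x ` actions m"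
    then obtain d where d: "d \<in> actions m" "v = DCOE_action m u x d" by auto
    have "\<not> T_action m \<alpha> u x d < T_action m \<alpha> u x a"
      using T_op_le[OF valid \<alpha> d(1), of u x] a(2) by simp
    then show "DCOE_action m u x a \<le> v"
      using DCOE_action_less_iff[OF valid \<alpha>, of u x d a] d(2) by simp
  qed (use a in simp)
  with eq show "\<alpha> * u x = (INF a\<in>actions m. DCOE_action m u x a)" by simp
qed

lemma DCOE_selector_iff:
  assumes valid: "valid_model m" and \<alpha>: "\<alpha> > 0" and fp: "u = T_op m \<alpha> u"
  shows "DCOE_selector m \<alpha> u \<beta> \<longleftrightarrow> \<beta> \<in> policies m \<and> (\<forall>x. T_action m \<alpha> u x (\<beta> x) = u x)"
proof -
  have "T_action m \<alpha> u x (\<beta> x) = u x \<longleftrightarrow> \<alpha> * u x = DCOE_action m u x (\<beta> x)" for x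
    unfolding T_action_DCOE_action[OF valid \<alpha>] using total_rate_pos[OF valid] \<alpha>
    by (auto simp: divide_eq_eq algebra_simps)
  moreover have "is_arg_min (DCOE_action m u x) (\<lambda>a. a \<in> actions m) (\<beta> x)"
    if "\<beta> \<in> policies m" "T_action m \<alpha> u x (\<beta> x) = u x" for x
    using that T_op_le[OF valid \<alpha>, of _ u x] fun_cong[OF fp, of x]
    by (auto simp: is_arg_min_def policies_actions DCOE_action_less_iff[OF valid \<alpha>] not_less)
  ultimately show ?thesis unfolding DCOE_selector_def by blast
qed

text \<open>
  No policy beats value iteration: at every stage the iterates of a policy dominate those
  of the minimising operator.
\<close>

lemma discounted_cost_ge:
  fixes P :: "policy \<Rightarrow> state \<Rightarrow> 'w measure"
  assumes valid: "valid_model m" and \<alpha>: "\<alpha> > 0"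
    and chains: "controlled_chains m P Y" and \<beta>: "\<beta> \<in> policies m"
    and lim: "(\<lambda>k. value_iter m \<alpha> k x) \<longlonglongrightarrow> l"
  shows "ennreal l \<le> discounted_cost m \<alpha> P Y \<beta> x"
proof -
  have act: "\<beta> y \<in> actions m" for y by (rule policies_actions[OF \<beta>])
  have le: "value_iter m \<alpha> k x \<le> policy_iter m \<alpha> \<beta> k x" for k x
  proof (induction k arbitrary: x)
    case 0
    show ?case by (simp add: policy_iter_0)
  next
    case (Suc k)
    have "value_iter m \<alpha> (Suc k) x \<le> T_action m \<alpha> (value_iter m \<alpha> k) x (\<beta> x)"
      unfolding value_iter_Suc by (rule T_op_le[OF valid \<alpha> act])
    also have "\<dots> \<le> policy_iter m \<alpha> \<beta> (Suc k) x"
      unfolding policy_iter_Suc[OF valid \<alpha>] by (rule T_action_mono[OF valid \<alpha> act Suc.IH])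
    finally show ?case .
  qed
  have "ennreal (value_iter m \<alpha> k x) \<le> discounted_cost m \<alpha> P Y \<beta> x" for k
    unfolding discounted_cost_eq_SUP[OF valid \<alpha> chains \<beta>]
    by (rule SUP_upper2[of k]) (auto intro: ennreal_leI le)
  then show ?thesis
    by (intro LIMSEQ_le_const2[OF tendsto_ennrealI[OF lim]]) auto
qed

text \<open>
  A policy costs at most any nonnegative supersolution of its own equation. No growth condition on the
  supersolution is needed, because the iteration starts below it in \<open>0\<close>.
\<close>

lemma discounted_cost_le:
  fixes P :: "policy \<Rightarrow> state \<Rightarrow> 'w measure"
  assumes valid: "valid_model m" and \<alpha>: "\<alpha> > 0"
    and chains: "controlled_chains m P Y" and \<beta>: "\<beta> \<in> policies m"
    and nonneg: "\<And>x. 0 \<le> s x" and super: "\<And>x. T_action m \<alpha> s x (\<beta> x) \<le> s x"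
  shows "discounted_cost m \<alpha> P Y \<beta> x \<le> ennreal (s x)"
proof -
  have act: "\<beta> y \<in> actions m" for y by (rule policies_actions[OF \<beta>])
  have le: "policy_iter m \<alpha> \<beta> k x \<le> s x" for k x
  proof (induction k arbitrary: x)
    case 0
    show ?case by (simp add: policy_iter_0 nonneg)
  next
    case (Suc k)
    show ?case
      unfolding policy_iter_Suc[OF valid \<alpha>]
      by (rule order_trans[OF T_action_mono[OF valid \<alpha> act Suc.IH] super])
  qed
  show ?thesis
    unfolding discounted_cost_eq_SUP[OF valid \<alpha> chains \<beta>]
    by (intro SUP_least ennreal_leI le)
qed

text \<open>
  A limit point of minimising policies attains the minimum in the fixed point equation: the values
  \<open>T_action m \<alpha> u x (\<beta>\<^sub>k x)\<close> converge to \<open>u x\<close>, while infinitely many of them are close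
  to \<open>T_action m \<alpha> u x (\<beta> x)\<close>.
\<close>

lemma limit_point_attains:
  assumes valid: "valid_model m" and \<alpha>: "\<alpha> > 0"
    and lim: "\<And>x. (\<lambda>k. value_iter m \<alpha> k x) \<longlonglongrightarrow> u x"
    and sel: "iteration_selectors m \<alpha> \<beta>s" and lp: "seq_limit_point \<beta>s \<beta>"
  shows "T_action m \<alpha> u x (\<beta> x) = u x"
proof (rule ccontr)
  assume ne: "T_action m \<alpha> u x (\<beta> x) \<noteq> u x"
  have act: "\<beta>s k x \<in> actions m" for k
    using sel policies_actions unfolding iteration_selectors_def by blast
  have "(\<lambda>k. value_iter m \<alpha> (Suc k) x
      - (T_action m \<alpha> (value_iter m \<alpha> k) x (\<beta>s k x) - T_action m \<alpha> u x (\<beta>s k x))) \<longlonglongrightarrow> u x - 0"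
    by (intro tendsto_diff LIMSEQ_Suc[OF lim] tendsto_T_action_diff[OF valid \<alpha> lim] act)
  moreover have "value_iter m \<alpha> (Suc k) x = T_action m \<alpha> (value_iter m \<alpha> k) x (\<beta>s k x)" for k
    using sel unfolding iteration_selectors_def by blast
  ultimately have conv: "(\<lambda>k. T_action m \<alpha> u x (\<beta>s k x)) \<longlonglongrightarrow> u x" by simp
  obtain U V where UV: "open U" "open V" "T_action m \<alpha> u x (\<beta> x) \<in> U" "u x \<in> V" "U \<inter> V = {}"
    using hausdorff[OF ne] by blast
  have cont: "continuous_on UNIV (\<lambda>f :: policy. T_action m \<alpha> u x (f x))"
    unfolding T_action_affine[OF valid \<alpha>, of u x "_ x"]
    by (intro continuous_intros continuous_on_product_coordinates)
  have "open ((\<lambda>f :: policy. T_action m \<alpha> u x (f x)) -` U)"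
    by (rule open_vimage[OF UV(1) cont])
  then have "\<exists>\<^sub>F k in sequentially. \<beta>s k \<in> (\<lambda>f :: policy. T_action m \<alpha> u x (f x)) -` U"
    using lp UV(3) unfolding seq_limit_point_def by blast
  moreover have "\<forall>\<^sub>F k in sequentially. T_action m \<alpha> u x (\<beta>s k x) \<in> V"
    by (rule topological_tendstoD[OF conv UV(2,4)])
  ultimately have "\<exists>\<^sub>F k in sequentially. T_action m \<alpha> u x (\<beta>s k x) \<in> U \<inter> V"
    by (auto elim!: frequently_rev_mp elim: eventually_mono)
  then obtain k where "T_action m \<alpha> u x (\<beta>s k x) \<in> U \<inter> V"
    using frequently_ex by blast
  with UV(5) show False by blast
qed

lemma value_iter_limit:
  assumes valid: "valid_model m" and \<alpha>: "\<alpha> > 0" and I: "assumption_I m W"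
  obtains u where "u \<in> weighted_space W" "\<And>x. 0 \<le> u x"
    "\<And>x. (\<lambda>k. value_iter m \<alpha> k x) \<longlonglongrightarrow> u x"
proof -
  obtain s where s: "s \<in> weighted_space W" "\<And>x. 0 \<le> s x" "\<And>x. T_op m \<alpha> s x \<le> s x"
    using supersolution[OF valid \<alpha> I] by blast
  have W: "\<And>x. 1 \<le> W x" using I unfolding assumption_I_def by blast
  have inc: "incseq (\<lambda>k. value_iter m \<alpha> k x)" for x
    by (intro incseq_SucI value_iter_le_Suc[OF valid \<alpha>])
  have le: "value_iter m \<alpha> k x \<le> s x" for k x
  proof (induction k arbitrary: x)
    case 0
    show ?case by (simp add: s)
  next
    case (Suc k)
    show ?case
      unfolding value_iter_Suc by (rule order_trans[OF T_op_mono[OF valid \<alpha> Suc.IH] s(3)])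
  qed
  have "\<exists>l. (\<lambda>k. value_iter m \<alpha> k x) \<longlonglongrightarrow> l" for x
    using incseq_convergent[OF inc, of x "s x"] le by metis
  then obtain u where u: "\<And>x. (\<lambda>k. value_iter m \<alpha> k x) \<longlonglongrightarrow> u x" by metis
  have u0: "0 \<le> u x" for x
    using incseq_le[OF inc u, of 0 x] by simp
  have "u x \<le> s x" for x
    by (rule LIMSEQ_le_const2[OF u]) (use le in blast)
  then have "\<bar>u x\<bar> \<le> \<bar>s x\<bar>" for x using u0[of x] by (simp add: order_trans[OF _ abs_ge_self])
  moreover obtain B where "B \<ge> 0" "\<And>x. \<bar>s x\<bar> \<le> B * W x"
    using s(1) weighted_space_iff[of W, OF W] by blast
  ultimately have "u \<in> weighted_space W"
    using weighted_space_iff[of W, OF W] order_trans by metis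
  then show thesis using u0 u by (rule that)
qed

lemma iteration_selectors_exist:
  assumes valid: "valid_model m" and \<alpha>: "\<alpha> > 0"
  shows "\<exists>\<beta>s. iteration_selectors m \<alpha> \<beta>s"
proof -
  have "\<exists>a. a \<in> actions m \<and> T_op m \<alpha> (value_iter m \<alpha> k) x = T_action m \<alpha> (value_iter m \<alpha> k) x a" for k x
    using T_op_attained[OF valid \<alpha>] by metis
  then obtain \<beta>s where \<beta>s: "\<And>k x. \<beta>s k x \<in> actions m"
      "\<And>k x. T_op m \<alpha> (value_iter m \<alpha> k) x = T_action m \<alpha> (value_iter m \<alpha> k) x (\<beta>s k x)"
    by metis
  have "\<not> T_action m \<alpha> (value_iter m \<alpha> k) x a < T_action m \<alpha> (value_iter m \<alpha> k) x (\<beta>s k x)"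
    if "a \<in> actions m" for k x a
    using T_op_le[OF valid \<alpha> that, of "value_iter m \<alpha> k" x] \<beta>s(2)[of k x] by simp
  then have "iteration_selectors m \<alpha> \<beta>s"
    unfolding iteration_selectors_def is_arg_min_def policies_def value_iter_Suc
    using \<beta>s by blast
  then show ?thesis by blast
qed

theorem theorem4p1:
  fixes m :: inventory_model and W :: "state \<Rightarrow> real" and \<alpha> :: real
    and P :: "policy \<Rightarrow> state \<Rightarrow> 'w measure"
    and Y :: "policy \<Rightarrow> state \<Rightarrow> real \<Rightarrow> 'w \<Rightarrow> state"
  assumes "valid_model m"
    and "assumption_I m W"
    and "assumption_II m W"
    and "\<alpha> > 0"
    and "controlled_chains m P Y"
  shows "(\<forall>u\<in>weighted_space W. T_op m \<alpha> u \<in> weighted_space W) \<and>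
    incseq (value_iter m \<alpha>) \<and>
    (\<exists>u\<in>weighted_space W.
       (\<forall>x. (\<lambda>k. value_iter m \<alpha> k x) \<longlonglongrightarrow> u x) \<and>
       u = T_op m \<alpha> u \<and> DCOE m \<alpha> u \<and>
       (\<exists>\<beta>s. iteration_selectors m \<alpha> \<beta>s) \<and>
       (\<exists>\<beta>. DCOE_selector m \<alpha> u \<beta>) \<and>
       (\<forall>x. enn2ereal (optimal_cost m \<alpha> P Y x) = ereal (u x)) \<and>
       (\<forall>\<beta>. DCOE_selector m \<alpha> u \<beta> \<longrightarrow> discount_optimal m \<alpha> P Y \<beta>) \<and>
       (\<forall>\<beta>s \<beta>. iteration_selectors m \<alpha> \<beta>s \<and> \<beta> \<in> policies m \<and> seq_limit_point \<beta>s \<beta> \<longrightarrow>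
          discount_optimal m \<alpha> P Y \<beta>))"
proof -
  note valid = assms(1) and I = assms(2) and \<alpha> = assms(4) and chains = assms(5)
  obtain u where uW: "u \<in> weighted_space W" and u0: "\<And>x. 0 \<le> u x"
    and lim: "\<And>x. (\<lambda>k. value_iter m \<alpha> k x) \<longlonglongrightarrow> u x"
    using value_iter_limit[OF valid \<alpha> I] by blast
  have inc: "incseq (value_iter m \<alpha>)"
    by (intro incseq_SucI le_funI value_iter_le_Suc[OF valid \<alpha>])
  have fp: "u = T_op m \<alpha> u"
  proof
    fix x
    have "(\<lambda>k. value_iter m \<alpha> (Suc k) x) \<longlonglongrightarrow> T_op m \<alpha> u x"
      unfolding value_iter_Suc by (rule tendsto_T_op[OF valid \<alpha> lim])
    then show "u x = T_op m \<alpha> u x"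
      by (rule LIMSEQ_unique[OF LIMSEQ_Suc[OF lim]])
  qed
  have "\<exists>a. a \<in> actions m \<and> T_action m \<alpha> u x a = u x" for x
    using T_op_attained[OF valid \<alpha>, of u x] fp by metis
  then obtain \<beta>0 where "\<And>x. \<beta>0 x \<in> actions m" "\<And>x. T_action m \<alpha> u x (\<beta>0 x) = u x" by metis
  then have \<beta>0: "\<beta>0 \<in> policies m" "\<And>x. T_action m \<alpha> u x (\<beta>0 x) = u x"
    by (auto simp: policies_def)
  have cost: "discounted_cost m \<alpha> P Y \<beta> x = ennreal (u x)"
    if "\<beta> \<in> policies m" "\<And>x. T_action m \<alpha> u x (\<beta> x) = u x" for \<beta> x
    by (intro antisym discounted_cost_le[OF valid \<alpha> chains] discounted_cost_ge[OF valid \<alpha> chains])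
       (use that u0 lim in auto)
  have opt: "optimal_cost m \<alpha> P Y x = ennreal (u x)" for x
  proof (rule antisym)
    show "optimal_cost m \<alpha> P Y x \<le> ennreal (u x)"
      unfolding optimal_cost_def by (rule INF_lower2[OF \<beta>0(1)]) (simp add: cost[OF \<beta>0])
    show "ennreal (u x) \<le> optimal_cost m \<alpha> P Y x"
      unfolding optimal_cost_def by (intro INF_greatest discounted_cost_ge[OF valid \<alpha> chains _ lim])
  qed
  have optimal: "discount_optimal m \<alpha> P Y \<beta>"
    if "\<beta> \<in> policies m" "\<And>x. T_action m \<alpha> u x (\<beta> x) = u x" for \<beta>
    using that cost opt by (simp add: discount_optimal_def)
  show ?thesis
  proof (intro conjI bexI[OF _ uW] ballI allI impI)
    show "T_op m \<alpha> v \<in> weighted_space W" if "v \<in> weighted_space W" for v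
      by (rule T_op_weighted_space[OF valid \<alpha> I that])
    show "\<exists>\<beta>. DCOE_selector m \<alpha> u \<beta>"
      using \<beta>0 DCOE_selector_iff[OF valid \<alpha> fp] by blast
    show "enn2ereal (optimal_cost m \<alpha> P Y x) = ereal (u x)" for x
      using opt u0 by (simp add: enn2ereal_ennreal)
    show "discount_optimal m \<alpha> P Y \<beta>" if "DCOE_selector m \<alpha> u \<beta>" for \<beta>
      using that DCOE_selector_iff[OF valid \<alpha> fp] optimal by blast
    show "discount_optimal m \<alpha> P Y \<beta>"
      if "iteration_selectors m \<alpha> \<beta>s \<and> \<beta> \<in> policies m \<and> seq_limit_point \<beta>s \<beta>" for \<beta>s \<beta>
      using that by (intro optimal limit_point_attains[OF valid \<alpha> lim]) auto
  qed (fact inc lim fp DCOE_if_fixed_point[OF valid \<alpha> fp] iteration_selectors_exist[OF valid \<alpha>])+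
qed

end
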